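(* There is a locally countable partial order $(P,\leq_P)$ of size continuum and height three with the following properties: (1) the first level $P_1$ of $P$ has size continuum; (2) if $f$ is any function from $P$ into the Turing degrees such that the image of $f$ on $P_1$ contains a perfect set (i.e. there is a perfect set $A\subseteq 2^\omega$ such that the Turing degree of every element of $A$ lies in $f(P_1)$), then $f$ is not an embedding.
   Context: A partial order $(P,\leq_P)$ is locally countable if every element has at most countably many strict predecessors. It has height $n$ if its longest chain has length exactly $n$. For a partial order of finite height, its first level consists of the elements with no strict predecessors, its second level consists of the elements not in the first level all of whose strict predecessors lie in the first level, and its third level consists of elements not in the first two levels all of whose strict predecessors lie in the first two levels. An embedding into the Turing degrees is a map $f$ with $x\leq_P y\iff f(x)\leq_T f(y)$ for all $x,y\in P$. A perfect set is a nonempty closed subset of $2^\omega$ without isolated points. *)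

theory Defs
  imports "HOL-Analysis.Analysis" "HOL-Library.Equipollence"
begin

text \<open>Reals of Cantor space 2^omega are modelled as nat => bool, with the
product topology (HOL-Analysis Function_Topology, bool discrete).
The total B-recursive functions are defined in Kleene's style: the least
class containing zero, successor, projections and the characteristic function
of the set B, closed under composition, primitive recursion and regular
(total) minimisation.  An n-ary function is represented as nat list => nat,
only its values on lists of length n being relevant.\<close>

definition prim_rec_op :: "(nat list \<Rightarrow> nat) \<Rightarrow> (nat list \<Rightarrow> nat) \<Rightarrow> nat list \<Rightarrow> nat" where
  "prim_rec_op g h xs = rec_nat (g (tl xs)) (\<lambda>k acc. h (k # acc # tl xs)) (hd xs)"

inductive rec_in :: "(nat \<Rightarrow> bool) \<Rightarrow> nat \<Rightarrow> (nat list \<Rightarrow> nat) \<Rightarrow> bool" for B where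
  zero: "rec_in B n (\<lambda>xs. 0)"
| succ: "rec_in B 1 (\<lambda>xs. Suc (xs ! 0))"
| proj: "i < n \<Longrightarrow> rec_in B n (\<lambda>xs. xs ! i)"
| orac: "rec_in B 1 (\<lambda>xs. if B (xs ! 0) then 1 else 0)"
| comp: "rec_in B m g \<Longrightarrow> length hs = m \<Longrightarrow> (\<forall>h\<in>set hs. rec_in B n h)
          \<Longrightarrow> rec_in B n (\<lambda>xs. g (map (\<lambda>h. h xs) hs))"
| prim_rec: "rec_in B n g \<Longrightarrow> rec_in B (Suc (Suc n)) h
          \<Longrightarrow> rec_in B (Suc n) (prim_rec_op g h)"
| minimise: "rec_in B (Suc n) g \<Longrightarrow> (\<forall>ys. length ys = n \<longrightarrow> (\<exists>y. g (y # ys) = 0))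
          \<Longrightarrow> rec_in B n (\<lambda>ys. LEAST y. g (y # ys) = 0)"

definition turing_le :: "(nat \<Rightarrow> bool) \<Rightarrow> (nat \<Rightarrow> bool) \<Rightarrow> bool" where
  "turing_le A B \<longleftrightarrow> (\<exists>f. rec_in B 1 f \<and> (\<forall>x. f [x] = (if A x then 1 else 0)))"

definition turing_equiv :: "(nat \<Rightarrow> bool) \<Rightarrow> (nat \<Rightarrow> bool) \<Rightarrow> bool" where
  "turing_equiv A B \<longleftrightarrow> turing_le A B \<and> turing_le B A"

definition partial_order_on_set :: "'a set \<Rightarrow> ('a \<Rightarrow> 'a \<Rightarrow> bool) \<Rightarrow> bool" where
  "partial_order_on_set P le \<longleftrightarrow>
     (\<forall>x\<in>P. le x x) \<and>
     (\<forall>x\<in>P. \<forall>y\<in>P. le x y \<and> le y x \<longrightarrow> x = y) \<and>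
     (\<forall>x\<in>P. \<forall>y\<in>P. \<forall>z\<in>P. le x y \<and> le y z \<longrightarrow> le x z)"

definition strict_preds :: "'a set \<Rightarrow> ('a \<Rightarrow> 'a \<Rightarrow> bool) \<Rightarrow> 'a \<Rightarrow> 'a set" where
  "strict_preds P le x = {y\<in>P. le y x \<and> y \<noteq> x}"

definition locally_countable :: "'a set \<Rightarrow> ('a \<Rightarrow> 'a \<Rightarrow> bool) \<Rightarrow> bool" where
  "locally_countable P le \<longleftrightarrow> (\<forall>x\<in>P. countable (strict_preds P le x))"

definition is_chain :: "'a set \<Rightarrow> ('a \<Rightarrow> 'a \<Rightarrow> bool) \<Rightarrow> 'a set \<Rightarrow> bool" where
  "is_chain P le C \<longleftrightarrow> C \<subseteq> P \<and> (\<forall>x\<in>C. \<forall>y\<in>C. le x y \<or> le y x)"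

definition has_height :: "'a set \<Rightarrow> ('a \<Rightarrow> 'a \<Rightarrow> bool) \<Rightarrow> nat \<Rightarrow> bool" where
  "has_height P le n \<longleftrightarrow>
     (\<exists>C. is_chain P le C \<and> finite C \<and> card C = n) \<and>
     (\<forall>C. is_chain P le C \<longrightarrow> finite C \<and> card C \<le> n)"

definition first_level :: "'a set \<Rightarrow> ('a \<Rightarrow> 'a \<Rightarrow> bool) \<Rightarrow> 'a set" where
  "first_level P le = {x\<in>P. strict_preds P le x = {}}"

definition perfect_set :: "(nat \<Rightarrow> bool) set \<Rightarrow> bool" where
  "perfect_set A \<longleftrightarrow> A \<noteq> {} \<and> closed A \<and> (\<forall>x\<in>A. x islimpt A)"

text \<open>Embedding into the Turing degrees, a map given by representatives.\<close>
definition turing_embedding :: "'a set \<Rightarrow> ('a \<Rightarrow> 'a \<Rightarrow> bool) \<Rightarrow> ('a \<Rightarrow> nat \<Rightarrow> bool) \<Rightarrow> bool" where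
  "turing_embedding P le f \<longleftrightarrow> (\<forall>x\<in>P. \<forall>y\<in>P. le x y \<longleftrightarrow> turing_le (f x) (f y))"

end

theory Submission
  imports Defs "HOL-Library.Nat_Bijection"
begin

text \<open>
  The first level of the order consists of all reals; the second level has, for each sequence \<open>S\<close>
  of reals, a point above exactly the range of \<open>S\<close>; the third level has, for each such point and
  each further sequence \<open>F\<close>, a point just above it and the range of \<open>F\<close>.

  Suppose \<open>f\<close> is an embedding whose image of the first level contains a perfect set \<open>A\<close>. Let \<open>B\<close> be a
  countable dense subset of \<open>A\<close>, let \<open>S\<close> enumerate the preimages of \<open>B\<close>, and let \<open>c\<close> be the image of the
  second-level point of \<open>S\<close>. Then \<open>c\<close> computes every element of \<open>B\<close>, though not uniformly. The point
  is that for every real \<open>x\<close> there are six elements of \<open>A\<close> which together with \<open>c\<close> compute \<open>x\<close>. Taking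
  for \<open>x\<close> the image of another second-level point and for \<open>F\<close> the preimages of the six reals, one
  gets a third-level point whose image computes \<open>x\<close> although it is not above that point.

  The six reals come in three pairs, and each follows a target in \<open>B\<close>. At stage \<open>j\<close> one
  member of pair \<open>j mod 3\<close>, selected by the bit \<open>x j\<close>, leaves its target for a new one in \<open>B\<close>. The positions
  where this happens can be chosen as large as we like. A decoder that knows indices relative to \<open>c\<close> of
  the targets of pair \<open>j mod 3\<close> sees which member leaves, and where. It finds these indices from the
  two preceding positions: the first bounds an index, and by the second all wrong programs
  below the first have failed, so any program below the first that agrees with the real up to the second is correct.
\<close>

section \<open>Unary recursive functions\<close>

abbreviation pr :: "nat \<Rightarrow> nat \<Rightarrow> nat" ("\<langle>_,/ _\<rangle>") where "\<langle>a, b\<rangle> \<equiv> prod_encode (a, b)"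
abbreviation p1 :: "nat \<Rightarrow> nat" where "p1 z \<equiv> fst (prod_decode z)"
abbreviation p2 :: "nat \<Rightarrow> nat" where "p2 z \<equiv> snd (prod_decode z)"

text \<open>Several arguments are packed into one number, so no scheme carries an arity. Recursion
  and minimisation take the counter from the first component and the parameter from the
  second.\<close>

inductive urec :: "(nat \<Rightarrow> bool) \<Rightarrow> (nat \<Rightarrow> nat) \<Rightarrow> bool" for B where
  zero: "urec B (\<lambda>x. 0)"
| succ: "urec B Suc"
| p1: "urec B p1"
| p2: "urec B p2"
| orac: "urec B (\<lambda>x. of_bool (B x))"
| comp: "urec B f \<Longrightarrow> urec B g \<Longrightarrow> urec B (\<lambda>x. f (g x))"
| pair: "urec B f \<Longrightarrow> urec B g \<Longrightarrow> urec B (\<lambda>x. \<langle>f x, g x\<rangle>)"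
| prim: "urec B g \<Longrightarrow> urec B h \<Longrightarrow>
    urec B (\<lambda>x. rec_nat (g (p2 x)) (\<lambda>k r. h \<langle>k, \<langle>r, p2 x\<rangle>\<rangle>) (p1 x))"
| mini: "urec B g \<Longrightarrow> (\<forall>y. \<exists>k. g \<langle>k, y\<rangle> = 0) \<Longrightarrow> urec B (\<lambda>y. LEAST k. g \<langle>k, y\<rangle> = 0)"

text \<open>Replacing each oracle call by a computation of \<open>A\<close> from \<open>B\<close>
  leaves all other schemes as they are. This is what makes \<open>turing_le\<close>
  transitive.\<close>

lemma urec_relativize:
  assumes "urec A f" "urec B (\<lambda>x. of_bool (A x))"
  shows "urec B f"
  using assms(1)
proof induction
  case (mini g)
  then show ?case by (blast intro: urec.mini)
next
  case (comp f g)
  then show ?case by (intro urec.comp[of B f g])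
next
  case (prim g h)
  then show ?case by (intro urec.prim)
qed (rule assms(2) urec.zero urec.succ urec.p1 urec.p2 urec.pair; assumption?)+

section \<open>Kleene's functions on tuples as unary functions\<close>

primrec tup :: "nat list \<Rightarrow> nat" where
  "tup [] = 0"
| "tup (x # xs) = \<langle>x, tup xs\<rangle>"

text \<open>Minimisation in \<open>urec\<close> must be regular on all numbers, not only on codes of tuples, so
  arguments are first normalised to the code of a tuple of the right length.\<close>

primrec norm_tup :: "nat \<Rightarrow> nat \<Rightarrow> nat" where
  "norm_tup 0 z = 0"
| "norm_tup (Suc n) z = \<langle>p1 z, norm_tup n (p2 z)\<rangle>"

lemma urec_norm_tup: "urec B (norm_tup n)"
proof (induction n)
  case 0
  have "norm_tup 0 = (\<lambda>x. 0)" by auto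
  then show ?case by (simp add: urec.zero)
next
  case (Suc n)
  have "norm_tup (Suc n) = (\<lambda>x. \<langle>p1 x, norm_tup n (p2 x)\<rangle>)" by auto
  then show ?case using Suc by (simp add: urec.pair urec.p1 urec.comp[OF _ urec.p2])
qed

lemma norm_tup_tup: "length xs = n \<Longrightarrow> norm_tup n (tup xs) = tup xs"
  by (induction n arbitrary: xs) (auto simp: length_Suc_conv)

lemma norm_tup_eq_tup: "\<exists>xs. length xs = n \<and> norm_tup n z = tup xs"
proof (induction n arbitrary: z)
  case (Suc n)
  then obtain xs where "length xs = n" "norm_tup n (p2 z) = tup xs" by blast
  then show ?case by (intro exI[of _ "p1 z # xs"]) auto
qed auto

lemma urec_id: "urec B (\<lambda>x. x)"
  using urec.pair[OF urec.p1 urec.p2, of B] by simp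

text \<open>Induction over Kleene's schemes, with argument lists read as their codes
  \<open>tup\<close>.\<close>

lemma urec_of_rec_in:
  "rec_in B n f \<Longrightarrow> \<exists>F. urec B F \<and> (\<forall>xs. length xs = n \<longrightarrow> F (tup xs) = f xs)"
proof (induction rule: rec_in.induct)
  case (zero n)
  then show ?case using urec.zero by blast
next
  case succ
  have "Suc (p1 (tup xs)) = Suc (xs ! 0)" if "length xs = 1" for xs
    using that by (cases xs) auto
  then show ?case using urec.comp[OF urec.succ urec.p1] by blast
next
  case (proj i n)
  have "\<exists>F. urec B F \<and> (\<forall>xs. i < length xs \<longrightarrow> F (tup xs) = xs ! i)"
  proof (induction i)
    case 0
    have "p1 (tup xs) = xs ! 0" if "0 < length xs" for xs
      using that by (cases xs) auto
    then show ?case using urec.p1 by blast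
  next
    case (Suc i)
    then obtain F where F: "urec B F" "\<And>xs. i < length xs \<Longrightarrow> F (tup xs) = xs ! i" by blast
    have "F (p2 (tup xs)) = xs ! Suc i" if "Suc i < length xs" for xs
      using that F(2) by (cases xs) auto
    then show ?case using urec.comp[OF F(1) urec.p2] by blast
  qed
  then show ?case using proj by blast
next
  case orac
  have "of_bool (B (p1 (tup xs))) = (if B (xs ! 0) then 1 else 0)" if "length xs = 1" for xs
    using that by (cases xs) auto
  then show ?case using urec.comp[OF urec.orac urec.p1] by blast
next
  case (comp m g hs n)
  obtain G where G: "urec B G" "\<And>xs. length xs = m \<Longrightarrow> G (tup xs) = g xs" using comp by blast
  have "\<forall>h\<in>set hs. \<exists>F. urec B F \<and> (\<forall>xs. length xs = n \<longrightarrow> F (tup xs) = h xs)"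
    using comp by blast
  \<comment> \<open>The inner functions are bundled into one function whose value is the code of the
    tuple of their values, so composition becomes unary.\<close>
  then have "\<exists>F. urec B F \<and> (\<forall>xs. length xs = n \<longrightarrow> F (tup xs) = tup (map (\<lambda>h. h xs) hs))"
  proof (induction hs)
    case Nil
    then show ?case using urec.zero by auto
  next
    case (Cons h hs)
    then obtain F H where "urec B F" "\<forall>xs. length xs = n \<longrightarrow> F (tup xs) = tup (map (\<lambda>h. h xs) hs)"
      "urec B H" "\<forall>xs. length xs = n \<longrightarrow> H (tup xs) = h xs" by auto
    then show ?case by (intro exI[of _ "\<lambda>x. \<langle>H x, F x\<rangle>"]) (simp add: urec.pair)
  qed
  then obtain F where "urec B F" "\<forall>xs. length xs = n \<longrightarrow> F (tup xs) = tup (map (\<lambda>h. h xs) hs)"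
    by blast
  then show ?case
    using G comp.hyps(2) by (intro exI[of _ "\<lambda>x. G (F x)"]) (simp add: urec.comp)
next
  case (prim_rec n g h)
  then obtain G H where G: "urec B G" "\<And>xs. length xs = n \<Longrightarrow> G (tup xs) = g xs"
    and H: "urec B H" "\<And>xs. length xs = Suc (Suc n) \<Longrightarrow> H (tup xs) = h xs" by blast
  let ?F = "\<lambda>x. rec_nat (G (p2 x)) (\<lambda>k r. H \<langle>k, \<langle>r, p2 x\<rangle>\<rangle>) (p1 x)"
  have "?F (tup xs) = prim_rec_op g h xs" if len: "length xs = Suc n" for xs
  proof -
    obtain k ys where xs: "xs = k # ys" "length ys = n" using len by (cases xs) auto
    have "rec_nat (G (tup ys)) (\<lambda>k r. H \<langle>k, \<langle>r, tup ys\<rangle>\<rangle>) k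
        = rec_nat (g ys) (\<lambda>k r. h (k # r # ys)) k"
    proof (induction k)
      case 0
      show ?case using G(2) xs by simp
    next
      case (Suc k)
      then show ?case using H(2)[of "k # _ # ys"] xs by simp
    qed
    then show ?thesis using xs by (simp add: prim_rec_op_def)
  qed
  then show ?case using urec.prim[OF G(1) H(1)] by blast
next
  case (minimise n g)
  then obtain G where G: "urec B G" "\<And>xs. length xs = Suc n \<Longrightarrow> G (tup xs) = g xs" by blast
  let ?G = "\<lambda>z. G \<langle>p1 z, norm_tup n (p2 z)\<rangle>"
  have "urec B ?G"
    by (intro urec.comp[OF G(1)] urec.pair urec.p1 urec.comp[OF urec_norm_tup urec.p2])
  moreover have "\<exists>k. ?G \<langle>k, y\<rangle> = 0" for y
  proof -
    obtain ys where ys: "length ys = n" "norm_tup n y = tup ys" using norm_tup_eq_tup by blast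
    then obtain k where "g (k # ys) = 0" using minimise by blast
    then show ?thesis using G(2)[of "k # ys"] ys by (intro exI[of _ k]) simp
  qed
  ultimately have "urec B (\<lambda>y. LEAST k. ?G \<langle>k, y\<rangle> = 0)" by (intro urec.mini) auto
  moreover have "(LEAST k. ?G \<langle>k, tup ys\<rangle> = 0) = (LEAST k. g (k # ys) = 0)" if "length ys = n" for ys
    using that G(2)[of "_ # ys"] by (simp add: norm_tup_tup)
  ultimately show ?case by blast
qed

text \<open>\<open>rec_in\<close> is not extensional: it also sees values on lists of the wrong length.\<close>

definition recf :: "(nat \<Rightarrow> bool) \<Rightarrow> nat \<Rightarrow> (nat list \<Rightarrow> nat) \<Rightarrow> bool" where
  "recf B n f \<longleftrightarrow> (\<exists>g. rec_in B n g \<and> (\<forall>xs. length xs = n \<longrightarrow> g xs = f xs))"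

section \<open>Kleene's class contains pairing and its projections\<close>

lemma recf_cong: "recf B n f \<Longrightarrow> (\<And>xs. length xs = n \<Longrightarrow> f xs = g xs) \<Longrightarrow> recf B n g"
  unfolding recf_def by metis

lemma recf_rec_in: "rec_in B n f \<Longrightarrow> recf B n f"
  unfolding recf_def by blast

lemma recf_comp:
  assumes "recf B m g" "length hs = m" "\<forall>h\<in>set hs. recf B n h"
  shows "recf B n (\<lambda>xs. g (map (\<lambda>h. h xs) hs))"
proof -
  obtain g' where g': "rec_in B m g'" "\<And>xs. length xs = m \<Longrightarrow> g' xs = g xs"
    using assms(1) unfolding recf_def by blast
  have "\<forall>h\<in>set hs. \<exists>h'. rec_in B n h' \<and> (\<forall>xs. length xs = n \<longrightarrow> h' xs = h xs)"
    using assms(3) unfolding recf_def by blast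
  then obtain k where k: "\<forall>h\<in>set hs. rec_in B n (k h) \<and> (\<forall>xs. length xs = n \<longrightarrow> k h xs = h xs)"
    by metis
  have "rec_in B n (\<lambda>xs. g' (map (\<lambda>h. h xs) (map k hs)))"
    using k assms(2) by (intro rec_in.comp[OF g'(1)]) auto
  moreover have "g' (map (\<lambda>h. h xs) (map k hs)) = g (map (\<lambda>h. h xs) hs)" if "length xs = n" for xs
  proof -
    have "map (\<lambda>h. h xs) (map k hs) = map (\<lambda>h. h xs) hs" using k that by simp
    then show ?thesis using g'(2) assms(2) by (simp del: map_map)
  qed
  ultimately show ?thesis unfolding recf_def by blast
qed

lemma recf_comp1: "recf B 1 g \<Longrightarrow> recf B n h \<Longrightarrow> recf B n (\<lambda>xs. g [h xs])"
  using recf_comp[of B 1 g "[h]" n] by simp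

lemma recf_prim:
  assumes "recf B n g" "recf B (Suc (Suc n)) h"
  shows "recf B (Suc n) (\<lambda>xs. rec_nat (g (tl xs)) (\<lambda>k r. h (k # r # tl xs)) (hd xs))"
proof -
  obtain g' h' where *: "rec_in B n g'" "\<And>xs. length xs = n \<Longrightarrow> g' xs = g xs"
    "rec_in B (Suc (Suc n)) h'" "\<And>xs. length xs = Suc (Suc n) \<Longrightarrow> h' xs = h xs"
    using assms unfolding recf_def by metis
  have "prim_rec_op g' h' xs = rec_nat (g (tl xs)) (\<lambda>k r. h (k # r # tl xs)) (hd xs)"
    if "length xs = Suc n" for xs
    using that * by (simp add: prim_rec_op_def)
  then show ?thesis using rec_in.prim_rec[OF *(1,3)] unfolding recf_def by blast
qed

lemma recf_min:
  assumes "recf B (Suc n) g" "\<And>ys. length ys = n \<Longrightarrow> \<exists>y. g (y # ys) = 0"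
  shows "recf B n (\<lambda>ys. LEAST y. g (y # ys) = 0)"
proof -
  obtain g' where *: "rec_in B (Suc n) g'" "\<And>xs. length xs = Suc n \<Longrightarrow> g' xs = g xs"
    using assms unfolding recf_def by metis
  then have "rec_in B n (\<lambda>ys. LEAST y. g' (y # ys) = 0)"
    using assms(2) by (intro rec_in.minimise) auto
  then show ?thesis using * unfolding recf_def by (intro exI conjI) auto
qed

lemma recf_nth: "i < n \<Longrightarrow> recf B n (\<lambda>xs. xs ! i)"
  by (simp add: recf_rec_in rec_in.proj)

lemma recf_Suc: "recf B n f \<Longrightarrow> recf B n (\<lambda>xs. Suc (f xs))"
  using recf_comp1[OF recf_rec_in[OF rec_in.succ]] by simp

text \<open>Kleene's scheme recurses on the head of its list and keeps only the tail as parameters.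
  Feeding it \<open>m xs\<close> followed by all projections lets the bound be any function of
  \<open>xs\<close> and keeps all of \<open>xs\<close> available.\<close>

lemma recf_rec:
  assumes "recf B n m" "recf B n g" "recf B (Suc (Suc n)) h"
  shows "recf B n (\<lambda>xs. rec_nat (g xs) (\<lambda>k r. h (k # r # xs)) (m xs))"
proof -
  let ?hs = "m # map (\<lambda>i xs. xs ! i) [0..<n]"
  have "recf B n (\<lambda>xs. (\<lambda>xs. rec_nat (g (tl xs)) (\<lambda>k r. h (k # r # tl xs)) (hd xs)) (map (\<lambda>h. h xs) ?hs))"
    using assms(1) by (intro recf_comp[OF recf_prim[OF assms(2,3)]]) (auto intro: recf_nth)
  then show ?thesis
  proof (rule recf_cong)
    fix xs :: "nat list" assume "length xs = n"
    then have "map (\<lambda>h. h xs) (map (\<lambda>i xs. xs ! i) [0..<n]) = xs"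
      using map_nth[of xs] by (simp add: comp_def)
    then show "rec_nat (g (tl (map (\<lambda>h. h xs) ?hs))) (\<lambda>k r. h (k # r # tl (map (\<lambda>h. h xs) ?hs)))
        (hd (map (\<lambda>h. h xs) ?hs)) = rec_nat (g xs) (\<lambda>k r. h (k # r # xs)) (m xs)"
      by simp
  qed
qed

lemma recf_add:
  assumes "recf B n f" "recf B n g"
  shows "recf B n (\<lambda>xs. f xs + g xs)"
proof -
  have *: "rec_nat a (\<lambda>k r. Suc r) b = b + a" for a b :: nat by (induction b) auto
  have "recf B n (\<lambda>xs. rec_nat (g xs) (\<lambda>k r. Suc ((k # r # xs) ! 1)) (f xs))"
    by (rule recf_rec[OF assms]) (auto intro: recf_Suc recf_nth)
  then show ?thesis by (simp add: *)
qed

lemma recf_zero: "recf B n (\<lambda>xs. 0)"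
  by (simp add: recf_rec_in rec_in.zero)

lemma recf_pred:
  assumes "recf B n f"
  shows "recf B n (\<lambda>xs. f xs - 1)"
proof -
  have *: "rec_nat 0 (\<lambda>k r. k) b = b - 1" for b :: nat by (cases b) auto
  have "recf B n (\<lambda>xs. rec_nat 0 (\<lambda>k r. (k # r # xs) ! 0) (f xs))"
    by (rule recf_rec[OF assms recf_zero]) (auto intro: recf_nth)
  then show ?thesis by (simp add: *)
qed

lemma recf_diff:
  assumes "recf B n f" "recf B n g"
  shows "recf B n (\<lambda>xs. f xs - g xs)"
proof -
  have *: "rec_nat a (\<lambda>k r. r - 1) b = a - b" for a b :: nat by (induction b) auto
  have "recf B n (\<lambda>xs. rec_nat (f xs) (\<lambda>k r. (k # r # xs) ! 1 - 1) (g xs))"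
    by (rule recf_rec[OF assms(2,1)]) (intro recf_pred recf_nth, simp)
  then show ?thesis using * by simp
qed

lemma recf_triangle:
  assumes "recf B n f"
  shows "recf B n (\<lambda>xs. triangle (f xs))"
proof -
  have *: "rec_nat 0 (\<lambda>k r. r + Suc k) b = triangle b" for b :: nat by (induction b) auto
  have "recf B n (\<lambda>xs. rec_nat 0 (\<lambda>k r. (k # r # xs) ! 1 + Suc ((k # r # xs) ! 0)) (f xs))"
    by (rule recf_rec[OF assms recf_zero]) (auto intro!: recf_add recf_Suc recf_nth)
  then show ?thesis using * by simp
qed

lemma recf_pair:
  assumes "recf B n f" "recf B n g"
  shows "recf B n (\<lambda>xs. \<langle>f xs, g xs\<rangle>)"
  using assms by (simp add: prod_encode_def recf_add recf_triangle)

text \<open>Since \<open>prod_encode (a, b) = triangle (a + b) + a\<close>, the sum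
  \<open>a + b\<close> is the least \<open>s\<close> with \<open>z < triangle (Suc s)\<close>.
  Truncated subtraction expresses the inequality because minimisation looks for a zero. Both
  projections are then differences.\<close>

definition diagonal :: "nat \<Rightarrow> nat" where
  "diagonal z = (LEAST s. Suc z - triangle (Suc s) = 0)"

lemma diagonal_eq: "diagonal z = p1 z + p2 z"
proof -
  obtain a b where z: "z = \<langle>a, b\<rangle>" by (metis prod_decode_inverse surj_pair)
  have mono: "triangle s \<le> triangle t" if "s \<le> t" for s t
    using that by (induction rule: dec_induct) auto
  have "diagonal z = a + b" unfolding diagonal_def
  proof (rule Least_equality)
    show "Suc z - triangle (Suc (a + b)) = 0" by (simp add: z prod_encode_def)
    fix s assume s: "Suc z - triangle (Suc s) = 0"
    show "a + b \<le> s"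
    proof (rule ccontr)
      assume "\<not> a + b \<le> s"
      then have "triangle (Suc s) \<le> triangle (a + b)" by (intro mono) simp
      then show False using s by (simp add: z prod_encode_def)
    qed
  qed
  then show ?thesis by (simp add: z)
qed

lemma recf_diagonal: "recf B 1 (\<lambda>xs. diagonal (xs ! 0))"
proof -
  have "recf B (Suc 1) (\<lambda>xs. Suc (xs ! 1) - triangle (Suc (xs ! 0)))"
    by (intro recf_diff recf_Suc recf_triangle recf_nth) auto
  then have "recf B 1 (\<lambda>ys. LEAST s. Suc ((s # ys) ! 1) - triangle (Suc ((s # ys) ! 0)) = 0)"
  proof (rule recf_min)
    fix ys :: "nat list"
    have "s \<le> triangle s" for s by (induction s) auto
    then show "\<exists>s. Suc ((s # ys) ! 1) - triangle (Suc ((s # ys) ! 0)) = 0"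
      by (intro exI[of _ "ys ! 0"]) (simp del: triangle_Suc)
  qed
  then show ?thesis by (simp add: diagonal_def)
qed

lemma recf_p1: assumes "recf B n f" shows "recf B n (\<lambda>xs. p1 (f xs))"
proof -
  have "recf B n (\<lambda>xs. f xs - triangle (diagonal (f xs)))"
    using recf_comp1[OF recf_diagonal assms] assms by (simp add: recf_diff recf_triangle)
  moreover have "z - triangle (diagonal z) = p1 z" for z
  proof -
    obtain a b where "z = \<langle>a, b\<rangle>" by (metis prod_decode_inverse surj_pair)
    then show ?thesis by (simp add: diagonal_eq) (simp add: prod_encode_def)
  qed
  ultimately show ?thesis by simp
qed

lemma recf_p2: assumes "recf B n f" shows "recf B n (\<lambda>xs. p2 (f xs))"
proof -
  have "recf B n (\<lambda>xs. diagonal (f xs) - p1 (f xs))"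
    using recf_comp1[OF recf_diagonal assms] assms by (simp add: recf_diff recf_p1)
  then show ?thesis by (simp add: diagonal_eq)
qed

text \<open>The converse simulation: once pairing and its projections are available, each unary
  scheme is an instance of Kleene's, with the coded counter, accumulator and parameter as separate
  arguments.\<close>

lemma recf_of_urec: "urec B F \<Longrightarrow> recf B 1 (\<lambda>xs. F (xs ! 0))"
proof (induction rule: urec.induct)
  case orac
  have "(\<lambda>xs. of_bool (B (xs ! 0))) = (\<lambda>xs. if B (xs ! 0) then 1 else (0::nat))" by auto
  then show ?case using recf_rec_in[OF rec_in.orac, of B] by simp
next
  case (comp f g)
  then show ?case using recf_comp1[of B "\<lambda>xs. f (xs ! 0)" 1 "\<lambda>xs. g (xs ! 0)"] by simp
next
  case (prim g h)
  have "recf B 1 (\<lambda>xs. rec_nat (g (p2 (xs ! 0)))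
      (\<lambda>k r. h \<langle>(k # r # xs) ! 0, \<langle>(k # r # xs) ! 1, p2 ((k # r # xs) ! 2)\<rangle>\<rangle>) (p1 (xs ! 0)))"
  proof (rule recf_rec)
    show "recf B 1 (\<lambda>xs. p1 (xs ! 0))" by (intro recf_p1 recf_nth) simp
    have "recf B 1 (\<lambda>xs. p2 (xs ! 0))" by (intro recf_p2 recf_nth) simp
    from recf_comp1[OF prim.IH(1) this] show "recf B 1 (\<lambda>xs. g (p2 (xs ! 0)))" by simp
    have "recf B (Suc (Suc 1)) (\<lambda>xs. \<langle>xs ! 0, \<langle>xs ! 1, p2 (xs ! 2)\<rangle>\<rangle>)"
      by (intro recf_pair recf_p2 recf_nth) auto
    from recf_comp1[OF prim.IH(2) this]
    show "recf B (Suc (Suc 1)) (\<lambda>xs. h \<langle>xs ! 0, \<langle>xs ! 1, p2 (xs ! 2)\<rangle>\<rangle>)" by simp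
  qed
  then show ?case by (simp add: numeral_2_eq_2)
next
  case (mini g)
  have "recf B (Suc 1) (\<lambda>xs. \<langle>xs ! 0, xs ! 1\<rangle>)"
    by (intro recf_pair recf_nth) auto
  from recf_comp1[OF mini.IH(1) this]
  have "recf B (Suc 1) (\<lambda>xs. g \<langle>xs ! 0, xs ! 1\<rangle>)" by simp
  from recf_min[OF this] show ?case using mini by simp
next
  case (pair f g)
  then show ?case by (intro recf_pair)
qed (rule recf_zero recf_Suc recf_p1 recf_p2, (rule recf_nth, simp)?)+

lemma turing_le_iff_urec: "turing_le A B \<longleftrightarrow> urec B (\<lambda>x. of_bool (A x))"
proof
  assume "turing_le A B"
  then obtain f where f: "rec_in B 1 f" "\<And>x. f [x] = (if A x then 1 else 0)"
    unfolding turing_le_def by blast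
  obtain F where F: "urec B F" "\<And>xs. length xs = 1 \<Longrightarrow> F (tup xs) = f xs"
    using urec_of_rec_in[OF f(1)] by blast
  \<comment> \<open>The pair of \<open>x\<close> and 0 is the code of the list
    \<open>[x]\<close>.\<close>
  have "urec B (\<lambda>x. F \<langle>x, 0\<rangle>)"
    by (intro urec.comp[OF F(1)] urec.pair urec_id urec.zero)
  moreover have "F \<langle>x, 0\<rangle> = of_bool (A x)" for x
    using F(2)[of "[x]"] f(2)[of x] by simp
  ultimately show "urec B (\<lambda>x. of_bool (A x))" by simp
next
  assume "urec B (\<lambda>x. of_bool (A x))"
  from recf_of_urec[OF this] obtain g
    where "rec_in B 1 g" "\<And>xs. length xs = 1 \<Longrightarrow> g xs = of_bool (A (xs ! 0))"
    unfolding recf_def by blast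
  then show "turing_le A B" unfolding turing_le_def by (intro exI[of _ g]) auto
qed

lemma turing_le_trans: "turing_le A B \<Longrightarrow> turing_le B C \<Longrightarrow> turing_le A C"
  unfolding turing_le_iff_urec by (rule urec_relativize)

section \<open>Decidable and recursively enumerable predicates\<close>

lemma urec_p1: "urec B f \<Longrightarrow> urec B (\<lambda>x. p1 (f x))"
  by (rule urec.comp[OF urec.p1])

lemma urec_p2: "urec B f \<Longrightarrow> urec B (\<lambda>x. p2 (f x))"
  by (rule urec.comp[OF urec.p2])

lemma urec_Suc: "urec B f \<Longrightarrow> urec B (\<lambda>x. Suc (f x))"
  by (rule urec.comp[OF urec.succ])

lemma urec_const: "urec B (\<lambda>x. c)"
  by (induction c) (auto intro: urec.zero urec_Suc)

lemma urec_rec: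
  assumes n: "urec B n" and g: "urec B g" and h: "urec B (\<lambda>z. h (p1 z) (p1 (p2 z)) (p2 (p2 z)))"
  shows "urec B (\<lambda>x. rec_nat (g x) (\<lambda>k r. h k r x) (n x))"
  using urec.comp[OF urec.prim[OF g h] urec.pair[OF n urec_id]] by simp

lemma urec_add:
  assumes "urec B f" "urec B g"
  shows "urec B (\<lambda>x. f x + g x)"
proof -
  have *: "rec_nat a (\<lambda>k r. Suc r) b = a + b" for a b by (induction b) auto
  have "urec B (\<lambda>x. rec_nat (f x) (\<lambda>k r. Suc r) (g x))"
    by (intro urec_rec assms urec_Suc urec_p1 urec_p2 urec_id)
  then show ?thesis by (simp add: *)
qed

lemma urec_diff:
  assumes "urec B f" "urec B g"
  shows "urec B (\<lambda>x. f x - g x)"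
proof -
  have pred: "rec_nat 0 (\<lambda>k r. k) b = b - 1" for b :: nat by (cases b) auto
  have "urec B (\<lambda>z. rec_nat 0 (\<lambda>k r. k) (p1 (p2 z)))"
    by (intro urec_rec urec_p1 urec_p2 urec_id urec_const)
  then have "urec B (\<lambda>z. p1 (p2 z) - 1)" by (simp only: pred)
  then have "urec B (\<lambda>x. rec_nat (f x) (\<lambda>k r. r - 1) (g x))"
    by (intro urec_rec assms)
  moreover have "rec_nat a (\<lambda>k r. r - 1) b = a - b" for a b :: nat by (induction b) auto
  ultimately show ?thesis by simp
qed

lemma urec_mult:
  assumes "urec B f" "urec B g"
  shows "urec B (\<lambda>x. f x * g x)"
proof -
  have *: "rec_nat 0 (\<lambda>k r. r + a) b = a * b" for a b :: nat by (induction b) auto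
  have "urec B (\<lambda>x. rec_nat 0 (\<lambda>k r. r + f x) (g x))"
    by (intro urec_rec assms urec_add urec_const urec_p1 urec_p2 urec_id urec.comp[OF assms(1)])
  then show ?thesis by (simp add: *)
qed

lemma urec_power:
  assumes "urec B f"
  shows "urec B (\<lambda>x. c ^ f x)"
proof -
  have *: "rec_nat 1 (\<lambda>k r. c * r) b = c ^ b" for b by (induction b) auto
  have "urec B (\<lambda>x. rec_nat 1 (\<lambda>k r. c * r) (f x))"
    by (intro urec_rec assms urec_mult urec_const urec_p1 urec_p2 urec_id)
  then show ?thesis unfolding * .
qed

definition dec :: "(nat \<Rightarrow> bool) \<Rightarrow> (nat \<Rightarrow> bool) \<Rightarrow> bool" where
  "dec B P \<longleftrightarrow> urec B (\<lambda>x. of_bool (P x))"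

lemma dec_not: "dec B P \<Longrightarrow> dec B (\<lambda>x. \<not> P x)"
proof -
  assume "dec B P"
  then have "urec B (\<lambda>x. 1 - of_bool (P x))"
    unfolding dec_def by (intro urec_diff urec_const)
  moreover have "1 - of_bool b = (of_bool (\<not> b) :: nat)" for b by simp
  ultimately show ?thesis unfolding dec_def by simp
qed

lemma dec_conj: "dec B P \<Longrightarrow> dec B Q \<Longrightarrow> dec B (\<lambda>x. P x \<and> Q x)"
  unfolding dec_def of_bool_conj by (rule urec_mult)

lemma dec_disj: "dec B P \<Longrightarrow> dec B Q \<Longrightarrow> dec B (\<lambda>x. P x \<or> Q x)"
  using dec_not[OF dec_conj[OF dec_not dec_not], of B P Q] by simp

lemma dec_le: "urec B f \<Longrightarrow> urec B g \<Longrightarrow> dec B (\<lambda>x. f x \<le> g x)"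
proof -
  assume *: "urec B f" "urec B g"
  have "of_bool (f x \<le> g x) = 1 - (f x - g x)" for x by auto
  then show ?thesis using * unfolding dec_def by (simp add: urec_diff urec_const)
qed

lemma dec_less: "urec B f \<Longrightarrow> urec B g \<Longrightarrow> dec B (\<lambda>x. f x < g x)"
  unfolding not_le[symmetric] by (intro dec_not dec_le)

lemma dec_eq: "urec B f \<Longrightarrow> urec B g \<Longrightarrow> dec B (\<lambda>x. f x = g x)"
  unfolding eq_iff by (intro dec_conj dec_le)

lemma dec_comp: "dec B P \<Longrightarrow> urec B f \<Longrightarrow> dec B (\<lambda>x. P (f x))"
  unfolding dec_def by (rule urec.comp)

lemma dec_bex:
  assumes "urec B f" "dec B (\<lambda>z. P (p1 z) (p2 z))"
  shows "dec B (\<lambda>x. \<exists>i<f x. P i x)"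
proof -
  have *: "rec_nat 0 (\<lambda>i r. of_bool (r = 1 \<or> P i x)) n = (of_bool (\<exists>i<n. P i x) :: nat)" for n x
    by (induction n) (auto simp: less_Suc_eq)
  have "dec B (\<lambda>z. p1 (p2 z) = 1 \<or> P (p1 z) (p2 (p2 z)))"
    using dec_comp[OF assms(2), of "\<lambda>z. \<langle>p1 z, p2 (p2 z)\<rangle>"]
    by (intro dec_disj dec_eq) (simp_all add: urec.pair urec_p1 urec_p2 urec_id urec_const)
  then have "urec B (\<lambda>x. rec_nat 0 (\<lambda>i r. of_bool (r = 1 \<or> P i x)) (f x))"
    unfolding dec_def by (intro urec_rec assms urec_const)
  then show ?thesis unfolding dec_def * .
qed

lemma dec_ball:
  assumes "urec B f" "dec B (\<lambda>z. P (p1 z) (p2 z))"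
  shows "dec B (\<lambda>x. \<forall>i<f x. P i x)"
  using dec_not[OF dec_bex[OF assms(1) dec_not[OF assms(2)]]] by simp

lemma urec_Least:
  assumes "dec B (\<lambda>z. P (p1 z) (p2 z))" "\<And>x. \<exists>k. P k x"
  shows "urec B (\<lambda>x. LEAST k. P k x)"
  using urec.mini[OF dec_not[OF assms(1), unfolded dec_def]] assms(2) by simp

lemma urec_div:
  assumes "urec B f" "urec B g" "\<And>x. 0 < g x"
  shows "urec B (\<lambda>x. f x div g x)"
proof -
  have *: "f x div g x = (LEAST q. f x < Suc q * g x)" for x
  proof (rule Least_equality[symmetric])
    show "f x < Suc (f x div g x) * g x"
      using dividend_less_div_times[OF assms(3)[of x], of "f x"] by simp
    show "f x div g x \<le> q" if "f x < Suc q * g x" for q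
      using that assms(3)[of x] by (metis div_less_iff_less_mult less_Suc_eq_le)
  qed
  have "urec B (\<lambda>x. LEAST q. f x < Suc q * g x)"
  proof (rule urec_Least)
    show "dec B (\<lambda>z. f (p2 z) < Suc (p1 z) * g (p2 z))"
      by (intro dec_less urec_mult urec_Suc urec.p1 urec.comp[OF assms(1) urec.p2]
          urec.comp[OF assms(2) urec.p2])
    show "\<exists>q. f x < Suc q * g x" for x
      using assms(3)[of x] by (intro exI[of _ "f x"]) (cases "g x", auto)
  qed
  then show ?thesis by (simp only: *)
qed

lemma urec_mod:
  assumes "urec B f" "0 < c"
  shows "urec B (\<lambda>x. f x mod c)"
  unfolding minus_mult_div_eq_mod[symmetric]
  by (intro urec_diff urec_mult urec_div assms urec_const)

lemmas urec_intros = urec_id urec_const urec_p1 urec_p2 urec_Suc urec.pair urec_add urec_mult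

text \<open>Numbers stand for finite sets through their binary digits, so a search for a finite set
  is a search for a number.\<close>

lemma dec_mem_set_decode:
  assumes "urec B f" "urec B g"
  shows "dec B (\<lambda>x. f x \<in> set_decode (g x))"
proof -
  have "dec B (\<lambda>x. (g x div 2 ^ f x) mod 2 = 1)"
    by (intro dec_eq urec_mod urec_div urec_power assms urec_const) auto
  then show ?thesis by (simp add: set_decode_def odd_iff_mod_2_eq_one)
qed

text \<open>With this bound a universal quantifier over the members of a coded set becomes a
  quantifier bounded by the code.\<close>

lemma mem_set_decode_less: "u \<in> set_decode m \<Longrightarrow> u < m"
proof -
  assume "u \<in> set_decode m"
  then have "m div 2 ^ u \<noteq> 0" unfolding set_decode_def by (intro notI) simp
  then have "2 ^ u \<le> m" by (metis div_less not_le)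
  then show "u < m" using less_exp[of u] by linarith
qed

section \<open>Recursively enumerable predicates\<close>

definition re :: "(nat \<Rightarrow> bool) \<Rightarrow> (nat \<Rightarrow> bool) \<Rightarrow> bool" where
  "re B P \<longleftrightarrow> (\<exists>Q. dec B (\<lambda>z. Q (p1 z) (p2 z)) \<and> (\<forall>x. P x \<longleftrightarrow> (\<exists>k. Q k x)))"

lemma reI: "dec B (\<lambda>z. Q (p1 z) (p2 z)) \<Longrightarrow> (\<And>x. P x \<longleftrightarrow> (\<exists>k. Q k x)) \<Longrightarrow> re B P"
  unfolding re_def by blast

lemma reE:
  assumes "re B P"
  obtains Q where "dec B (\<lambda>z. Q (p1 z) (p2 z))" "\<And>x. P x \<longleftrightarrow> (\<exists>k. Q k x)"
  using assms unfolding re_def by blast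

lemma dec_comp2:
  assumes "dec B (\<lambda>z. Q (p1 z) (p2 z))" "urec B f" "urec B g"
  shows "dec B (\<lambda>x. Q (f x) (g x))"
  using dec_comp[OF assms(1) urec.pair[OF assms(2,3)]] by simp

lemma re_dec: "dec B P \<Longrightarrow> re B P"
  by (rule reI[where Q = "\<lambda>k. P", OF dec_comp[OF _ urec.p2]]) auto

lemma re_comp:
  assumes "re B P" "urec B f"
  shows "re B (\<lambda>x. P (f x))"
proof -
  obtain Q where Q: "dec B (\<lambda>z. Q (p1 z) (p2 z))" "\<And>x. P x \<longleftrightarrow> (\<exists>k. Q k x)"
    using assms(1) by (auto elim: reE)
  show ?thesis
    by (rule reI[where Q = "\<lambda>k x. Q k (f x)"])
      (use Q(2) in \<open>auto intro!: dec_comp2[OF Q(1)] urec.comp[OF assms(2)] urec.p1 urec.p2\<close>)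
qed

lemma re_conj:
  assumes "re B P" "re B P'"
  shows "re B (\<lambda>x. P x \<and> P' x)"
proof -
  obtain Q where Q: "dec B (\<lambda>z. Q (p1 z) (p2 z))" "\<And>x. P x \<longleftrightarrow> (\<exists>k. Q k x)"
    using reE[OF assms(1)] by blast
  obtain Q' where Q': "dec B (\<lambda>z. Q' (p1 z) (p2 z))" "\<And>x. P' x \<longleftrightarrow> (\<exists>k. Q' k x)"
    using reE[OF assms(2)] by blast
  show ?thesis
  proof (rule reI[where Q = "\<lambda>k x. Q (p1 k) x \<and> Q' (p2 k) x"])
    show "dec B (\<lambda>z. Q (p1 (p1 z)) (p2 z) \<and> Q' (p2 (p1 z)) (p2 z))"
      by (intro dec_conj dec_comp2[OF Q(1)] dec_comp2[OF Q'(1)] urec_intros)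
    have "Q k x \<Longrightarrow> Q' k' x \<Longrightarrow> \<exists>k. Q (p1 k) x \<and> Q' (p2 k) x" for k k' x
      by (rule exI[of _ "\<langle>k, k'\<rangle>"]) simp
    then show "(P x \<and> P' x) = (\<exists>k. Q (p1 k) x \<and> Q' (p2 k) x)" for x
      unfolding Q(2) Q'(2) by blast
  qed
qed

lemma re_disj:
  assumes "re B P" "re B P'"
  shows "re B (\<lambda>x. P x \<or> P' x)"
proof -
  obtain Q where Q: "dec B (\<lambda>z. Q (p1 z) (p2 z))" "\<And>x. P x \<longleftrightarrow> (\<exists>k. Q k x)"
    using reE[OF assms(1)] by blast
  obtain Q' where Q': "dec B (\<lambda>z. Q' (p1 z) (p2 z))" "\<And>x. P' x \<longleftrightarrow> (\<exists>k. Q' k x)"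
    using reE[OF assms(2)] by blast
  show ?thesis
    by (rule reI[where Q = "\<lambda>k x. Q k x \<or> Q' k x"])
      (use Q(2) Q'(2) dec_disj[OF Q(1) Q'(1)] in auto)
qed

lemma re_ex:
  assumes "re B (\<lambda>z. P (p1 z) (p2 z))"
  shows "re B (\<lambda>x. \<exists>i. P i x)"
proof -
  obtain Q where Q: "dec B (\<lambda>z. Q (p1 z) (p2 z))" "\<And>z. P (p1 z) (p2 z) \<longleftrightarrow> (\<exists>k. Q k z)"
    using assms by (auto elim: reE)
  show ?thesis
  proof (rule reI[where Q = "\<lambda>k x. Q (p1 k) \<langle>p2 k, x\<rangle>"])
    show "dec B (\<lambda>z. Q (p1 (p1 z)) \<langle>p2 (p1 z), p2 z\<rangle>)"
      by (intro dec_comp2[OF Q(1)] urec_intros)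
    have "Q k \<langle>i, x\<rangle> \<Longrightarrow> \<exists>k. Q (p1 k) \<langle>p2 k, x\<rangle>" for k i x
      by (rule exI[of _ "\<langle>k, i\<rangle>"]) simp
    then show "(\<exists>i. P i x) = (\<exists>k. Q (p1 k) \<langle>p2 k, x\<rangle>)" for x
      using Q(2)[of "\<langle>_, x\<rangle>"] by auto
  qed
qed

text \<open>Finitely many witnesses have a common bound, their sum plus one, so a single unbounded
  quantifier can be moved in front of the bounded one.\<close>

lemma re_ball:
  assumes "urec B f" "re B (\<lambda>z. P (p1 z) (p2 z))"
  shows "re B (\<lambda>x. \<forall>i<f x. P i x)"
proof -
  obtain Q where Q: "dec B (\<lambda>z. Q (p1 z) (p2 z))" "\<And>z. P (p1 z) (p2 z) \<longleftrightarrow> (\<exists>k. Q k z)"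
    using assms by (auto elim: reE)
  show ?thesis
  proof (rule reI[where Q = "\<lambda>m x. \<forall>i<f x. \<exists>k<m. Q k \<langle>i, x\<rangle>"])
    show "dec B (\<lambda>z. \<forall>i<f (p2 z). \<exists>k<p1 z. Q k \<langle>i, p2 z\<rangle>)"
      by (intro dec_ball dec_bex dec_comp2[OF Q(1)] urec.comp[OF assms(1)] urec_intros)
    show "(\<forall>i<f x. P i x) = (\<exists>m. \<forall>i<f x. \<exists>k<m. Q k \<langle>i, x\<rangle>)" for x
    proof
      assume "\<forall>i<f x. P i x"
      then have "\<forall>i. i < f x \<longrightarrow> (\<exists>k. Q k \<langle>i, x\<rangle>)" using Q(2)[of "\<langle>_, x\<rangle>"] by auto
      then obtain w where w: "\<And>i. i < f x \<Longrightarrow> Q (w i) \<langle>i, x\<rangle>" by metis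
      have "w i < Suc (\<Sum>i<f x. w i)" if "i < f x" for i
        using member_le_sum[of i "{..<f x}" w] that by (simp add: less_Suc_eq_le)
      then show "\<exists>m. \<forall>i<f x. \<exists>k<m. Q k \<langle>i, x\<rangle>" using w by blast
    next
      assume "\<exists>m. \<forall>i<f x. \<exists>k<m. Q k \<langle>i, x\<rangle>"
      then show "\<forall>i<f x. P i x" using Q(2)[of "\<langle>_, x\<rangle>"] by auto
    qed
  qed
qed

lemma re_bex:
  assumes "urec B f" "re B (\<lambda>z. P (p1 z) (p2 z))"
  shows "re B (\<lambda>x. \<exists>i<f x. P i x)"
  by (intro re_ex re_conj assms(2) re_dec dec_less urec.comp[OF assms(1)] urec_intros)

text \<open>The search for a value together with a witness for it ends at every argument, and
  whatever value it finds is the right one.\<close>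

lemma dec_of_re_graph:
  assumes "re B (\<lambda>z. p2 z = of_bool (X (p1 z)))"
  shows "dec B X"
proof -
  obtain Q where Q: "dec B (\<lambda>z. Q (p1 z) (p2 z))"
      "\<And>z. p2 z = of_bool (X (p1 z)) \<longleftrightarrow> (\<exists>k. Q k z)"
    using assms by (auto elim: reE)
  define g where "g x = (LEAST k. Q (p1 k) \<langle>x, p2 k\<rangle>)" for x
  have ex: "\<exists>k. Q (p1 k) \<langle>x, p2 k\<rangle>" for x
  proof -
    obtain k where "Q k \<langle>x, of_bool (X x)\<rangle>" using Q(2)[of "\<langle>x, of_bool (X x)\<rangle>"] by auto
    then show ?thesis by (intro exI[of _ "\<langle>k, of_bool (X x)\<rangle>"]) simp
  qed
  have g: "urec B g" unfolding g_def
    by (rule urec_Least[OF _ ex]) (intro dec_comp2[OF Q(1)] urec_intros)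
  have "Q (p1 (g x)) \<langle>x, p2 (g x)\<rangle>" for x unfolding g_def by (rule LeastI_ex[OF ex])
  then have "p2 (g x) = of_bool (X x)" for x using Q(2)[of "\<langle>x, p2 (g x)\<rangle>"] by auto
  then show ?thesis using urec_p2[OF g] unfolding dec_def by simp
qed

section \<open>Closures under rules with two premises\<close>

inductive ind_closure :: "(nat \<Rightarrow> bool) \<Rightarrow> (nat \<Rightarrow> nat \<Rightarrow> nat \<Rightarrow> bool) \<Rightarrow> nat \<Rightarrow> bool" for E D where
  base: "E z \<Longrightarrow> ind_closure E D z"
| step: "D w w' z \<Longrightarrow> ind_closure E D w \<Longrightarrow> ind_closure E D w' \<Longrightarrow> ind_closure E D z"

text \<open>The elements \<open>\<langle>r, z\<rangle>\<close> of a derivation carry a rank \<open>r\<close>, which makes mutual justification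
  well-founded.\<close>

definition derivation :: "(nat \<Rightarrow> bool) \<Rightarrow> (nat \<Rightarrow> nat \<Rightarrow> nat \<Rightarrow> bool) \<Rightarrow> nat set \<Rightarrow> bool" where
  "derivation E D X \<longleftrightarrow> (\<forall>u\<in>X. E (p2 u) \<or>
     (\<exists>v v'. v \<in> X \<and> v' \<in> X \<and> p1 v < p1 u \<and> p1 v' < p1 u \<and> D (p2 v) (p2 v') (p2 u)))"

lemma derivation_Un: "derivation E D X \<Longrightarrow> derivation E D Y \<Longrightarrow> derivation E D (X \<union> Y)"
  unfolding derivation_def by blast

lemma ind_closure_iff_derivation:
  "ind_closure E D z \<longleftrightarrow> (\<exists>X r. finite X \<and> derivation E D X \<and> \<langle>r, z\<rangle> \<in> X)"
proof
  assume "ind_closure E D z"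
  then show "\<exists>X r. finite X \<and> derivation E D X \<and> \<langle>r, z\<rangle> \<in> X"
  proof induction
    case (base z)
    then show ?case by (intro exI[of _ "{\<langle>0, z\<rangle>}"] exI[of _ 0]) (auto simp: derivation_def)
  next
    case (step w w' z)
    then obtain X X' r r' where X: "finite X" "derivation E D X" "\<langle>r, w\<rangle> \<in> X"
      "finite X'" "derivation E D X'" "\<langle>r', w'\<rangle> \<in> X'" by blast
    \<comment> \<open>This rank exceeds \<open>r\<close> and \<open>r'\<close>, as the new element
      must rank above both premises.\<close>
    let ?u = "\<langle>Suc (r + r'), z\<rangle>"
    have "derivation E D (X \<union> X')" using X derivation_Un by blast
    moreover have "\<exists>v v'. v \<in> X \<union> X' \<and> v' \<in> X \<union> X' \<and> p1 v < p1 ?u \<and> p1 v' < p1 ?u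
        \<and> D (p2 v) (p2 v') (p2 ?u)"
      using X step.hyps(1) by (intro exI[of _ "\<langle>r, w\<rangle>"] exI[of _ "\<langle>r', w'\<rangle>"]) auto
    ultimately have "derivation E D (insert ?u (X \<union> X'))"
      unfolding derivation_def by blast
    then show ?case using X by (intro exI[of _ "insert ?u (X \<union> X')"] exI[of _ "Suc (r + r')"]) auto
  qed
next
  assume "\<exists>X r. finite X \<and> derivation E D X \<and> \<langle>r, z\<rangle> \<in> X"
  then obtain X r where X: "derivation E D X" "\<langle>r, z\<rangle> \<in> X" by blast
  have "u \<in> X \<Longrightarrow> ind_closure E D (p2 u)" for u
  proof (induction "p1 u" arbitrary: u rule: less_induct)
    case less
    then show ?case using X(1) unfolding derivation_def by (blast intro: ind_closure.intros)
  qed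
  from this[OF X(2)] show "ind_closure E D z" by simp
qed

text \<open>Membership is a search for the code \<open>m\<close> of a finite derivation, and being a
  derivation is a bounded universal quantifier over enumerable conditions. The lemma serves twice:
  for the evaluation of programs and for the decoder.\<close>

lemma re_ind_closure:
  assumes E: "re B E" and D: "re B (\<lambda>z. D (p1 z) (p1 (p2 z)) (p2 (p2 z)))"
  shows "re B (ind_closure E D)"
proof -
  have D': "re B (\<lambda>x. D (f x) (g x) (h x))" if "urec B f" "urec B g" "urec B h" for f g h
    using re_comp[OF D urec.pair[OF that(1) urec.pair[OF that(2,3)]]] by simp
  have "re B (\<lambda>z. \<exists>m r. (\<forall>u<m. u \<notin> set_decode m \<or> E (p2 u) \<or>
      (\<exists>v v'. v \<in> set_decode m \<and> v' \<in> set_decode m \<and> p1 v < p1 u \<and> p1 v' < p1 u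
        \<and> D (p2 v) (p2 v') (p2 u))) \<and> \<langle>r, z\<rangle> \<in> set_decode m)"
    by (intro re_ex re_ball re_conj re_disj re_comp[OF E] D' re_dec dec_not dec_mem_set_decode
        dec_less urec_intros)
  moreover have "(\<forall>u<m. u \<notin> set_decode m \<or> E (p2 u) \<or>
      (\<exists>v v'. v \<in> set_decode m \<and> v' \<in> set_decode m \<and> p1 v < p1 u \<and> p1 v' < p1 u
        \<and> D (p2 v) (p2 v') (p2 u))) \<longleftrightarrow> derivation E D (set_decode m)" for m
    unfolding derivation_def using mem_set_decode_less by blast
  ultimately have "re B (\<lambda>z. \<exists>m r. derivation E D (set_decode m) \<and> \<langle>r, z\<rangle> \<in> set_decode m)"
    by simp
  moreover have "ind_closure E D z \<longleftrightarrow> (\<exists>m r. derivation E D (set_decode m) \<and> \<langle>r, z\<rangle> \<in> set_decode m)" for z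
    unfolding ind_closure_iff_derivation by (metis finite_set_decode set_encode_inverse)
  then have "ind_closure E D = (\<lambda>z. \<exists>m r. derivation E D (set_decode m) \<and> \<langle>r, z\<rangle> \<in> set_decode m)"
    by (intro ext)
  ultimately show ?thesis by simp
qed

section \<open>A universal evaluation relation\<close>

text \<open>The code \<open>\<langle>8, a\<rangle>\<close> searches for a zero upwards from \<open>k\<close>, not from \<open>0\<close>, so that no rule needs more
  than two premises.\<close>

inductive ev :: "(nat \<Rightarrow> bool) \<Rightarrow> nat \<Rightarrow> nat \<Rightarrow> nat \<Rightarrow> bool" for c where
  zero: "ev c \<langle>0, t\<rangle> x 0"
| succ: "ev c \<langle>1, t\<rangle> x (Suc x)"
| p1: "ev c \<langle>2, t\<rangle> x (p1 x)"
| p2: "ev c \<langle>3, t\<rangle> x (p2 x)"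
| orac: "ev c \<langle>4, t\<rangle> x (of_bool (c x))"
| comp: "ev c b x u \<Longrightarrow> ev c a u v \<Longrightarrow> ev c \<langle>5, \<langle>a, b\<rangle>\<rangle> x v"
| pair: "ev c a x u \<Longrightarrow> ev c b x v \<Longrightarrow> ev c \<langle>6, \<langle>a, b\<rangle>\<rangle> x \<langle>u, v\<rangle>"
| prim_0: "ev c a y v \<Longrightarrow> ev c \<langle>7, \<langle>a, b\<rangle>\<rangle> \<langle>0, y\<rangle> v"
| prim_Suc: "ev c \<langle>7, \<langle>a, b\<rangle>\<rangle> \<langle>k, y\<rangle> u \<Longrightarrow> ev c b \<langle>k, \<langle>u, y\<rangle>\<rangle> v \<Longrightarrow> ev c \<langle>7, \<langle>a, b\<rangle>\<rangle> \<langle>Suc k, y\<rangle> v"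
| mini_0: "ev c a \<langle>k, y\<rangle> 0 \<Longrightarrow> ev c \<langle>8, a\<rangle> \<langle>k, y\<rangle> k"
| mini_Suc: "ev c a \<langle>k, y\<rangle> (Suc u) \<Longrightarrow> ev c \<langle>8, a\<rangle> \<langle>Suc k, y\<rangle> v \<Longrightarrow> ev c \<langle>8, a\<rangle> \<langle>k, y\<rangle> v"

text \<open>The tag of the code selects the rule. Where two rules share a tag, the counter of the
  recursion or the inner value of the search decides between them.\<close>

lemma ev_deterministic: "ev c e x v \<Longrightarrow> ev c e x v' \<Longrightarrow> v = v'"
proof (induction arbitrary: v' rule: ev.induct)
  case zero from zero.prems show ?case by cases auto
next
  case succ from succ.prems show ?case by cases auto
next
  case p1 from p1.prems show ?case by cases auto
next
  case p2 from p2.prems show ?case by cases auto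
next
  case orac from orac.prems show ?case by cases auto
next
  case comp from comp.prems comp.IH show ?case by cases auto
next
  case pair from pair.prems pair.IH show ?case by cases auto
next
  case prim_0 from prim_0.prems prim_0.IH show ?case by cases auto
next
  case prim_Suc from prim_Suc.prems prim_Suc.IH show ?case by cases auto
next
  case mini_0 from mini_0.prems mini_0.IH show ?case by cases auto
next
  case mini_Suc from mini_Suc.prems mini_Suc.IH show ?case by cases auto
qed

text \<open>Each scheme of \<open>urec\<close> has its own tag. Since minimisation starts at 0, its
  code is the searching code composed with a program that pairs 0 with the input.\<close>

lemma ev_complete: "urec c F \<Longrightarrow> \<exists>e. \<forall>x. ev c e x (F x)"
proof (induction rule: urec.induct)
  case (comp f g)
  then show ?case by (metis ev.comp)
next
  case (pair f g)
  then show ?case by (metis ev.pair)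
next
  case (prim g h)
  then obtain a b where ab: "\<And>x. ev c a x (g x)" "\<And>x. ev c b x (h x)" by blast
  have "ev c \<langle>7, \<langle>a, b\<rangle>\<rangle> \<langle>k, y\<rangle> (rec_nat (g y) (\<lambda>k r. h \<langle>k, \<langle>r, y\<rangle>\<rangle>) k)" for k y
  proof (induction k)
    case 0
    show ?case using ab(1) by (simp add: ev.prim_0)
  next
    case (Suc k)
    show ?case using ev.prim_Suc[OF Suc ab(2)] by simp
  qed
  from this[of "p1 x" "p2 x" for x]
  have "ev c \<langle>7, \<langle>a, b\<rangle>\<rangle> x (rec_nat (g (p2 x)) (\<lambda>k r. h \<langle>k, \<langle>r, p2 x\<rangle>\<rangle>) (p1 x))" for x by simp
  then show ?case by blast
next
  case (mini g)
  then obtain a where a: "\<And>x. ev c a x (g x)" by blast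
  let ?m = "\<lambda>y. LEAST k. g \<langle>k, y\<rangle> = 0"
  \<comment> \<open>The induction goes down from the least zero: a search started \<open>i\<close>
    places before it succeeds. Taking \<open>i\<close> maximal gives the search from 0.\<close>
  have "ev c \<langle>8, a\<rangle> \<langle>?m y - i, y\<rangle> (?m y)" if "i \<le> ?m y" for i y
    using that
  proof (induction i)
    case 0
    have "g \<langle>?m y, y\<rangle> = 0" using mini.hyps LeastI_ex[of "\<lambda>k. g \<langle>k, y\<rangle> = 0"] by blast
    then show ?case using ev.mini_0[of c a "?m y" y] a[of "\<langle>?m y, y\<rangle>"] by simp
  next
    case (Suc i)
    let ?k = "?m y - Suc i"
    have "g \<langle>?k, y\<rangle> \<noteq> 0" using Suc.prems not_less_Least[of ?k "\<lambda>k. g \<langle>k, y\<rangle> = 0"] by simp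
    then obtain u where "g \<langle>?k, y\<rangle> = Suc u" by (cases "g \<langle>?k, y\<rangle>") auto
    then have "ev c a \<langle>?k, y\<rangle> (Suc u)" using a[of "\<langle>?k, y\<rangle>"] by simp
    moreover have "Suc ?k = ?m y - i" using Suc.prems by simp
    ultimately show ?case using Suc ev.mini_Suc[of c a ?k y u "?m y"] by simp
  qed
  from this[OF order_refl] have m: "ev c \<langle>8, a\<rangle> \<langle>0, y\<rangle> (?m y)" for y by simp
  let ?id = "\<langle>6, \<langle>\<langle>2, 0\<rangle>, \<langle>3, 0\<rangle>\<rangle>\<rangle>"
  have "ev c ?id y y" for y using ev.pair[OF ev.p1 ev.p2] by simp
  then have "ev c \<langle>6, \<langle>\<langle>0, 0\<rangle>, ?id\<rangle>\<rangle> y \<langle>0, y\<rangle>" for y by (intro ev.pair ev.zero)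
  then have "ev c \<langle>5, \<langle>\<langle>8, a\<rangle>, \<langle>6, \<langle>\<langle>0, 0\<rangle>, ?id\<rangle>\<rangle>\<rangle>\<rangle> y (?m y)" for y
    using m by (rule ev.comp)
  then show ?case by blast
qed (rule exI, rule allI, rule ev.intros)+

section \<open>Evaluation is recursively enumerable\<close>

definition ev_base :: "(nat \<Rightarrow> bool) \<Rightarrow> nat \<Rightarrow> bool" where
  "ev_base c z \<longleftrightarrow>
    (\<exists>t x. z = \<langle>\<langle>0, t\<rangle>, \<langle>x, 0\<rangle>\<rangle>) \<or>
    (\<exists>t x. z = \<langle>\<langle>1, t\<rangle>, \<langle>x, Suc x\<rangle>\<rangle>) \<or>
    (\<exists>t x. z = \<langle>\<langle>2, t\<rangle>, \<langle>x, p1 x\<rangle>\<rangle>) \<or>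
    (\<exists>t x. z = \<langle>\<langle>3, t\<rangle>, \<langle>x, p2 x\<rangle>\<rangle>) \<or>
    (\<exists>t x. z = \<langle>\<langle>4, t\<rangle>, \<langle>x, of_bool (c x)\<rangle>\<rangle>)"

text \<open>Evaluations are coded as triples of program, input and value. Rules with one premise
  leave \<open>w'\<close> unconstrained; when such a rule is applied, the premise is supplied
  twice.\<close>

definition ev_step :: "nat \<Rightarrow> nat \<Rightarrow> nat \<Rightarrow> bool" where
  "ev_step w w' z \<longleftrightarrow>
    (\<exists>a b x u v. w = \<langle>b, \<langle>x, u\<rangle>\<rangle> \<and> w' = \<langle>a, \<langle>u, v\<rangle>\<rangle> \<and> z = \<langle>\<langle>5, \<langle>a, b\<rangle>\<rangle>, \<langle>x, v\<rangle>\<rangle>) \<or>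
    (\<exists>a b x u v. w = \<langle>a, \<langle>x, u\<rangle>\<rangle> \<and> w' = \<langle>b, \<langle>x, v\<rangle>\<rangle> \<and> z = \<langle>\<langle>6, \<langle>a, b\<rangle>\<rangle>, \<langle>x, \<langle>u, v\<rangle>\<rangle>\<rangle>) \<or>
    (\<exists>a b y v. w = \<langle>a, \<langle>y, v\<rangle>\<rangle> \<and> z = \<langle>\<langle>7, \<langle>a, b\<rangle>\<rangle>, \<langle>\<langle>0, y\<rangle>, v\<rangle>\<rangle>) \<or>
    (\<exists>a b k y u v. w = \<langle>\<langle>7, \<langle>a, b\<rangle>\<rangle>, \<langle>\<langle>k, y\<rangle>, u\<rangle>\<rangle> \<and> w' = \<langle>b, \<langle>\<langle>k, \<langle>u, y\<rangle>\<rangle>, v\<rangle>\<rangle>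
       \<and> z = \<langle>\<langle>7, \<langle>a, b\<rangle>\<rangle>, \<langle>\<langle>Suc k, y\<rangle>, v\<rangle>\<rangle>) \<or>
    (\<exists>a k y. w = \<langle>a, \<langle>\<langle>k, y\<rangle>, 0\<rangle>\<rangle> \<and> z = \<langle>\<langle>8, a\<rangle>, \<langle>\<langle>k, y\<rangle>, k\<rangle>\<rangle>) \<or>
    (\<exists>a k y u v. w = \<langle>a, \<langle>\<langle>k, y\<rangle>, Suc u\<rangle>\<rangle> \<and> w' = \<langle>\<langle>8, a\<rangle>, \<langle>\<langle>Suc k, y\<rangle>, v\<rangle>\<rangle>
       \<and> z = \<langle>\<langle>8, a\<rangle>, \<langle>\<langle>k, y\<rangle>, v\<rangle>\<rangle>)"

lemma ind_closure_imp_ev: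
  "ind_closure (ev_base c) ev_step z \<Longrightarrow> ev c (p1 z) (p1 (p2 z)) (p2 (p2 z))"
proof (induction rule: ind_closure.induct)
  case (base z)
  then show ?case unfolding ev_base_def
    by (elim disjE exE) (simp_all add: ev.intros ev.succ[unfolded One_nat_def])
next
  case (step w w' z)
  from step.hyps(1) step.IH show ?case unfolding ev_step_def
    by (elim disjE exE conjE) (simp_all, (blast intro: ev.intros)+)
qed

lemma ev_imp_ind_closure: "ev c e x v \<Longrightarrow> ind_closure (ev_base c) ev_step \<langle>e, \<langle>x, v\<rangle>\<rangle>"
proof (induction rule: ev.induct)
  case comp
  show ?case by (rule ind_closure.step[OF _ comp.IH]) (simp add: ev_step_def)
next
  case pair
  show ?case by (rule ind_closure.step[OF _ pair.IH]) (simp add: ev_step_def)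
next
  case prim_0
  show ?case by (rule ind_closure.step[OF _ prim_0.IH prim_0.IH]) (simp add: ev_step_def)
next
  case prim_Suc
  show ?case by (rule ind_closure.step[OF _ prim_Suc.IH]) (simp add: ev_step_def)
next
  case mini_0
  show ?case by (rule ind_closure.step[OF _ mini_0.IH mini_0.IH]) (simp add: ev_step_def)
next
  case mini_Suc
  show ?case by (rule ind_closure.step[OF _ mini_Suc.IH]) (simp add: ev_step_def)
qed (rule ind_closure.base, simp add: ev_base_def)+

text \<open>The evaluated programs use the oracle \<open>c\<close> and the enumeration uses
  \<open>d\<close>; the two meet only in the base case for oracle calls.\<close>

lemma re_ev:
  assumes c: "urec d (\<lambda>x. of_bool (c x))"
    and "urec d f" "urec d g" "urec d h"
  shows "re d (\<lambda>x. ev c (f x) (g x) (h x))"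
proof -
  have "re d (ev_base c)" unfolding ev_base_def
    by (intro re_disj re_ex re_dec dec_eq urec_intros urec.comp[OF c])
  moreover have "re d (\<lambda>z. ev_step (p1 z) (p1 (p2 z)) (p2 (p2 z)))" unfolding ev_step_def
    by (intro re_disj re_ex re_dec dec_conj dec_eq urec_intros)
  ultimately have "re d (ind_closure (ev_base c) ev_step)" by (rule re_ind_closure)
  from re_comp[OF this, of "\<lambda>x. \<langle>f x, \<langle>g x, h x\<rangle>\<rangle>"]
  have "re d (\<lambda>x. ind_closure (ev_base c) ev_step \<langle>f x, \<langle>g x, h x\<rangle>\<rangle>)"
    using assms by (simp add: urec.pair)
  moreover have "ind_closure (ev_base c) ev_step \<langle>f x, \<langle>g x, h x\<rangle>\<rangle> \<longleftrightarrow> ev c (f x) (g x) (h x)" for x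
    using ind_closure_imp_ev[of c "\<langle>f x, \<langle>g x, h x\<rangle>\<rangle>"] ev_imp_ind_closure by auto
  ultimately show ?thesis by simp
qed

section \<open>Coding a real into six elements of a perfect set\<close>

declare split_of_bool [split del]

text \<open>\<open>T g \<beta>\<close> is the current target of member \<open>\<beta>\<close> of
  pair \<open>g\<close>, and \<open>N'\<close> is the position chosen at stage \<open>j\<close>. Two
  clauses about the targets before the change prepare the decoding: each has an index at most
  \<open>N'\<close>, and a program up to the old \<open>N\<close> that reproduces one through
  \<open>N'\<close> reproduces it everywhere.\<close>

definition coding_step :: "(nat \<Rightarrow> bool) \<Rightarrow> (nat \<Rightarrow> bool) \<Rightarrow> nat \<Rightarrow>
    (nat \<Rightarrow> bool \<Rightarrow> nat \<Rightarrow> bool) \<times> nat \<Rightarrow> (nat \<Rightarrow> bool \<Rightarrow> nat \<Rightarrow> bool) \<times> nat \<Rightarrow> bool" where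
  "coding_step c x j = (\<lambda>(T, N) (T', N').
     N < N' \<and>
     (\<forall>g\<in>{..<3}. \<forall>\<beta>. \<exists>e\<le>N'. \<forall>t. ev c e t (of_bool (T g \<beta> t))) \<and>
     (\<forall>g\<in>{..<3}. \<forall>\<beta>. \<forall>e\<in>{..N}. (\<forall>t\<le>N'. ev c e t (of_bool (T g \<beta> t))) \<longrightarrow> (\<forall>t. ev c e t (of_bool (T g \<beta> t)))) \<and>
     (\<forall>g \<beta>. (g, \<beta>) \<noteq> (j mod 3, x j) \<longrightarrow> T' g \<beta> = T g \<beta>) \<and>
     (\<forall>t<N'. T' (j mod 3) (x j) t = T (j mod 3) (x j) t) \<and>
     T' (j mod 3) (x j) N' \<noteq> T (j mod 3) (x j) N')"

text \<open>Each requirement on the position holds for all large \<open>n\<close>, and there are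
  finitely many of them. By \<open>split\<close> a target can be left at arbitrarily large
  positions.\<close>

lemma coding_step_exists:
  assumes B: "\<And>b. b \<in> B \<Longrightarrow> turing_le b c"
    and split: "\<And>b N. b \<in> B \<Longrightarrow> \<exists>b'\<in>B. \<exists>n\<ge>N. (\<forall>t<n. b' t = b t) \<and> b' n \<noteq> b n"
    and T: "\<And>g \<beta>. T g \<beta> \<in> B"
  shows "\<exists>T' N'. (\<forall>g \<beta>. T' g \<beta> \<in> B) \<and> coding_step c x j (T, N) (T', N')"
proof -
  have 1: "\<forall>\<^sub>F n in sequentially. \<exists>e\<le>n. \<forall>t. ev c e t (of_bool (T g \<beta> t))" for g \<beta>
  proof -
    obtain e where "\<forall>t. ev c e t (of_bool (T g \<beta> t))"
      using ev_complete B[OF T] unfolding turing_le_iff_urec by blast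
    then show ?thesis by (intro eventually_mono[OF eventually_ge_at_top[of e]]) blast
  qed
  have 2: "\<forall>\<^sub>F n in sequentially. (\<forall>t\<le>n. ev c e t (of_bool (T g \<beta> t))) \<longrightarrow> (\<forall>t. ev c e t (of_bool (T g \<beta> t)))"
    for e g \<beta>
  proof (cases "\<forall>t. ev c e t (of_bool (T g \<beta> t))")
    case False
    then obtain t where "\<not> ev c e t (of_bool (T g \<beta> t))" by blast
    then show ?thesis by (intro eventually_mono[OF eventually_ge_at_top[of t]]) blast
  qed simp
  have "\<forall>\<^sub>F n in sequentially. N < n \<and>
     (\<forall>g\<in>{..<3}. \<forall>\<beta>\<in>UNIV. \<exists>e\<le>n. \<forall>t. ev c e t (of_bool (T g \<beta> t))) \<and>
     (\<forall>g\<in>{..<3}. \<forall>\<beta>\<in>UNIV. \<forall>e\<in>{..N}. (\<forall>t\<le>n. ev c e t (of_bool (T g \<beta> t))) \<longrightarrow> (\<forall>t. ev c e t (of_bool (T g \<beta> t))))"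
    by (intro eventually_conj eventually_gt_at_top eventually_ball_finite ballI 1 2) auto
  then obtain M where M: "\<And>n. n \<ge> M \<Longrightarrow> N < n \<and>
     (\<forall>g\<in>{..<3}. \<forall>\<beta>\<in>UNIV. \<exists>e\<le>n. \<forall>t. ev c e t (of_bool (T g \<beta> t))) \<and>
     (\<forall>g\<in>{..<3}. \<forall>\<beta>\<in>UNIV. \<forall>e\<in>{..N}. (\<forall>t\<le>n. ev c e t (of_bool (T g \<beta> t))) \<longrightarrow> (\<forall>t. ev c e t (of_bool (T g \<beta> t))))"
    unfolding eventually_sequentially by blast
  obtain b n where b: "b \<in> B" "n \<ge> M" "\<forall>t<n. b t = T (j mod 3) (x j) t" "b n \<noteq> T (j mod 3) (x j) n"
    using split[OF T] by blast
  let ?T' = "T(j mod 3 := (T (j mod 3))(x j := b))"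
  have "coding_step c x j (T, N) (?T', n)"
    using M[OF b(2)] b(3,4) by (simp add: coding_step_def)
  moreover have "?T' g \<beta> \<in> B" for g \<beta> using b(1) T by simp
  ultimately show ?thesis by blast
qed

section \<open>The limits of the targets\<close>

locale coding =
  fixes c x :: "nat \<Rightarrow> bool" and T :: "nat \<Rightarrow> nat \<Rightarrow> bool \<Rightarrow> nat \<Rightarrow> bool" and N :: "nat \<Rightarrow> nat"
  assumes step: "coding_step c x j (T j, N j) (T (Suc j), N (Suc j))"
begin

text \<open>From stage \<open>n\<close> on only positions at or beyond \<open>N (Suc n)\<close>,
  which exceeds \<open>n\<close>, can change. So \<open>T n g \<beta>\<close> is already final at
  \<open>n\<close>.\<close>

definition y :: "nat \<Rightarrow> bool \<Rightarrow> nat \<Rightarrow> bool" where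
  "y g \<beta> n = T n g \<beta> n"

lemma N_less: "N j < N (Suc j)"
  using step[of j] by (simp add: coding_step_def)

lemma N_mono: "i \<le> j \<Longrightarrow> N i \<le> N j"
  by (rule lift_Suc_mono_le[of N]) (use N_less less_imp_le in blast)

lemma N_ge: "j \<le> N j"
proof (induction j)
  case (Suc j)
  then show ?case using N_less[of j] by simp
qed simp

lemma T_other: "(g, \<beta>) \<noteq> (j mod 3, x j) \<Longrightarrow> T (Suc j) g \<beta> = T j g \<beta>"
  using step[of j] by (simp add: coding_step_def)

lemma T_agree_Suc: "t < N (Suc j) \<Longrightarrow> T (Suc j) g \<beta> t = T j g \<beta> t"
proof (cases "(g, \<beta>) = (j mod 3, x j)")
  case True
  have "\<forall>t<N (Suc j). T (Suc j) (j mod 3) (x j) t = T j (j mod 3) (x j) t"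
    using step[of j] by (simp add: coding_step_def)
  then show "t < N (Suc j) \<Longrightarrow> T (Suc j) g \<beta> t = T j g \<beta> t" using True by blast
next
  case False
  then show ?thesis using T_other by presburger
qed

lemma T_agree: "j \<le> k \<Longrightarrow> t < N (Suc j) \<Longrightarrow> T k g \<beta> t = T j g \<beta> t"
proof (induction k rule: dec_induct)
  case (step k)
  then have "t < N (Suc k)" using N_mono[of "Suc j" "Suc k"] by simp
  then show ?case using step T_agree_Suc by simp
qed simp

lemma y_eq_T: "t < N (Suc j) \<Longrightarrow> y g \<beta> t = T j g \<beta> t"
proof (cases "j \<le> t")
  case True
  then show "t < N (Suc j) \<Longrightarrow> y g \<beta> t = T j g \<beta> t" unfolding y_def by (rule T_agree)
next
  case False
  then have "T j g \<beta> t = T t g \<beta> t" using N_ge[of "Suc t"] by (intro T_agree) auto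
  then show ?thesis unfolding y_def by (rule sym)
qed

text \<open>The departure is never undone, because the next stage acts only from
  \<open>N (Suc (Suc j))\<close> on.\<close>

lemma y_leaves: "y (j mod 3) (x j) (N (Suc j)) \<noteq> T j (j mod 3) (x j) (N (Suc j))"
proof -
  have "T (Suc j) (j mod 3) (x j) (N (Suc j)) \<noteq> T j (j mod 3) (x j) (N (Suc j))"
    using step[of j] by (simp add: coding_step_def)
  then show ?thesis using y_eq_T[OF N_less[of "Suc j"]] by metis
qed

text \<open>The bound includes the departure position itself, since that is where the decoder has to
  tell the two members apart.\<close>

lemma y_stays:
  assumes "t \<le> N (Suc j)"
  shows "y (j mod 3) (\<not> x j) t = T j (j mod 3) (\<not> x j) t"
proof -
  have "t < N (Suc (Suc j))" using assms N_less[of "Suc j"] by linarith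
  from y_eq_T[OF this] have "y (j mod 3) (\<not> x j) t = T (Suc j) (j mod 3) (\<not> x j) t" .
  then show ?thesis using T_other[of "j mod 3" "\<not> x j" j] by simp
qed

text \<open>This is why there are three pairs: stages \<open>i\<close> and \<open>Suc i\<close> work
  on the other two, so what they secure about the targets of this pair still holds when its turn
  comes.\<close>

lemma T_unchanged:
  assumes "g = Suc (Suc i) mod 3"
  shows "T (Suc i) g \<beta> = T i g \<beta>" "T (Suc (Suc i)) g \<beta> = T i g \<beta>"
proof -
  have "g \<noteq> i mod 3" "g \<noteq> Suc i mod 3" unfolding assms by presburger+
  then show "T (Suc i) g \<beta> = T i g \<beta>" "T (Suc (Suc i)) g \<beta> = T i g \<beta>" using T_other by auto
qed

text \<open>Stage \<open>i\<close> chose \<open>N (Suc i)\<close> above an index of each of its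
  targets, and those of this pair have not changed since.\<close>

lemma index_exists:
  assumes "g = Suc (Suc i) mod 3"
  shows "\<exists>e\<le>N (Suc i). \<forall>t. ev c e t (of_bool (T (Suc (Suc i)) g \<beta> t))"
proof -
  have "\<forall>g\<in>{..<3}. \<forall>\<beta>. \<exists>e\<le>N (Suc i). \<forall>t. ev c e t (of_bool (T i g \<beta> t))"
    using step[of i] by (simp add: coding_step_def)
  moreover have "g \<in> {..<3}" using assms by simp
  ultimately show ?thesis unfolding T_unchanged(2)[OF assms] by blast
qed

text \<open>Stage \<open>Suc i\<close> chose its position so far out that every wrong program up to
  \<open>N (Suc i)\<close> has failed by then. Through that position \<open>y\<close> coincides with
  its target, so agreement with \<open>y\<close> is a sufficient test.\<close>

lemma index_correct:
  assumes g: "g = Suc (Suc i) mod 3" and e: "e \<le> N (Suc i)"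
    and agree: "\<And>t. t \<le> N (Suc (Suc i)) \<Longrightarrow> ev c e t (of_bool (y g \<beta> t))"
  shows "ev c e t (of_bool (T (Suc (Suc i)) g \<beta> t))"
proof -
  have "ev c e t (of_bool (T (Suc i) g \<beta> t))" if "t \<le> N (Suc (Suc i))" for t
    using agree[OF that] y_eq_T[of t "Suc (Suc i)" g \<beta>] that N_less[of "Suc (Suc i)"] T_unchanged[OF g]
    by auto
  moreover have "\<forall>g\<in>{..<3}. \<forall>\<beta>. \<forall>e\<in>{..N (Suc i)}.
      (\<forall>t\<le>N (Suc (Suc i)). ev c e t (of_bool (T (Suc i) g \<beta> t))) \<longrightarrow>
      (\<forall>t. ev c e t (of_bool (T (Suc i) g \<beta> t)))"
    using step[of "Suc i"] by (simp add: coding_step_def)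
  moreover have "g \<in> {..<3}" using g by simp
  ultimately have "ev c e t (of_bool (T (Suc i) g \<beta> t))" using e by blast
  then show ?thesis using T_unchanged[OF g] by simp
qed

section \<open>The decoder\<close>

definition decode_base :: "nat \<Rightarrow> bool" where
  "decode_base z \<longleftrightarrow> z = \<langle>0, \<langle>N 1, of_bool (x 0)\<rangle>\<rangle> \<or> z = \<langle>1, \<langle>N 2, of_bool (x 1)\<rangle>\<rangle>"

definition yval :: "nat \<Rightarrow> nat \<Rightarrow> nat \<Rightarrow> nat" where
  "yval j b t = of_bool (y (j mod 3) (b = 1) t)"

lemma yval_of_bool:
  "yval j (of_bool b) t = of_bool (y (j mod 3) b t)"
  "yval j (1 - of_bool b) t = of_bool (y (j mod 3) (\<not> b) t)"
  unfolding yval_def by (cases b; simp)+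

text \<open>A code holds a stage, a departure position and a bit; \<open>z\<close> is a guess for
  the stage following those of \<open>w\<close> and \<open>w'\<close>. One program must follow the
  guessed member up to the position and fail there, another must follow the other member through it.
  Failure is stated as output of the opposite bit, which keeps the condition recursively
  enumerable.\<close>

definition decode_step :: "nat \<Rightarrow> nat \<Rightarrow> nat \<Rightarrow> bool" where
  "decode_step w w' z \<longleftrightarrow> p1 w' = Suc (p1 w) \<and> p1 z = Suc (p1 w') \<and> p2 (p2 z) < 2 \<and> p1 (p2 w') < p1 (p2 z) \<and>
     (\<exists>e<Suc (p1 (p2 w)). (\<forall>t<p1 (p2 z). ev c e t (yval (p1 z) (p2 (p2 z)) t)) \<and>
        ev c e (p1 (p2 z)) (1 - yval (p1 z) (p2 (p2 z)) (p1 (p2 z)))) \<and>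
     (\<exists>e<Suc (p1 (p2 w)). \<forall>t<Suc (p1 (p2 z)). ev c e t (yval (p1 z) (1 - p2 (p2 z)) t))"

abbreviation decoded :: "nat \<Rightarrow> bool" where
  "decoded \<equiv> ind_closure decode_base decode_step"

text \<open>The guessed position \<open>n\<close> lies beyond the second known one, so by
  \<open>index_correct\<close> both programs compute targets. Hence the guessed member leaves its
  target at \<open>n\<close> and the other has not left by then. As nobody leaves before the true
  position, \<open>n\<close> is not too small. The true leaver has therefore left by
  \<open>n\<close>, so the bit is right; and as it agrees with its target below \<open>n\<close>,
  the position is not too large.\<close>

lemma decode_step_sound:
  assumes "decode_step \<langle>i, \<langle>N (Suc i), b\<rangle>\<rangle> \<langle>Suc i, \<langle>N (Suc (Suc i)), b'\<rangle>\<rangle> z"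
  shows "z = \<langle>Suc (Suc i), \<langle>N (Suc (Suc (Suc i))), of_bool (x (Suc (Suc i)))\<rangle>\<rangle>"
proof -
  let ?j = "Suc (Suc i)" and ?g = "Suc (Suc i) mod 3"
  define n p where "n = p1 (p2 z)" and "p \<longleftrightarrow> p2 (p2 z) = 1"
  have d: "p1 z = ?j" "p2 (p2 z) < 2" "N ?j < n"
    "\<exists>e<Suc (N (Suc i)). (\<forall>t<n. ev c e t (yval ?j (p2 (p2 z)) t)) \<and> ev c e n (1 - yval ?j (p2 (p2 z)) n)"
    "\<exists>e<Suc (N (Suc i)). \<forall>t<Suc n. ev c e t (yval ?j (1 - p2 (p2 z)) t)"
    using assms unfolding decode_step_def n_def[symmetric] by auto
  have \<beta>: "p2 (p2 z) = of_bool p" using d(2) unfolding p_def by (auto simp: less_2_cases_iff)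
  have z: "z = \<langle>?j, \<langle>n, of_bool p\<rangle>\<rangle>"
    using d(1) \<beta> unfolding n_def by (metis prod.collapse prod_decode_inverse)
  obtain e where e: "e \<le> N (Suc i)" "\<And>t. t < n \<Longrightarrow> ev c e t (of_bool (y ?g p t))"
    "ev c e n (1 - of_bool (y ?g p n))"
    using d(4) unfolding \<beta> yval_of_bool less_Suc_eq_le by blast
  obtain e' where e': "e' \<le> N (Suc i)" "\<And>t. t \<le> n \<Longrightarrow> ev c e' t (of_bool (y ?g (\<not> p) t))"
    using d(5) unfolding \<beta> yval_of_bool less_Suc_eq_le by blast
  have T: "ev c e t (of_bool (T ?j ?g p t))" for t
    using e(1,2) d(3) by (intro index_correct[OF refl]) auto
  have T': "ev c e' t (of_bool (T ?j ?g (\<not> p) t))" for t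
    using e' d(3) by (intro index_correct[OF refl]) auto
  have agree: "T ?j ?g p t = y ?g p t" if "t < n" for t
    using ev_deterministic[OF T e(2)[OF that]] by (simp add: of_bool_eq_iff)
  have diff: "T ?j ?g p n \<noteq> y ?g p n"
    using ev_deterministic[OF T e(3)] by (auto split: split_of_bool_asm)
  have agree': "T ?j ?g (\<not> p) t = y ?g (\<not> p) t" if "t \<le> n" for t
    using ev_deterministic[OF T' e'(2)[OF that]] by (simp add: of_bool_eq_iff)
  have ge: "N (Suc ?j) \<le> n" using y_eq_T[of n ?j ?g p] diff by force
  have p: "p = x ?j"
  proof (rule ccontr)
    assume "p \<noteq> x ?j"
    then have "(\<not> p) = x ?j" by simp
    then show False using y_leaves[of ?j] agree'[OF ge] by simp
  qed
  have "n \<le> N (Suc ?j)"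
    using agree[of "N (Suc ?j)"] y_leaves[of ?j] unfolding p by force
  then show ?thesis using z ge by (simp add: p)
qed

lemma decoded_sound: "decoded z \<Longrightarrow> \<exists>j. z = \<langle>j, \<langle>N (Suc j), of_bool (x j)\<rangle>\<rangle>"
proof (induction rule: ind_closure.induct)
  case (base z)
  then show ?case unfolding decode_base_def by (auto simp: numeral_2_eq_2)
next
  case (step w w' z)
  then obtain j j' where w: "w = \<langle>j, \<langle>N (Suc j), of_bool (x j)\<rangle>\<rangle>"
    "w' = \<langle>j', \<langle>N (Suc j'), of_bool (x j')\<rangle>\<rangle>" by blast
  moreover have "j' = Suc j" using step.hyps(1) unfolding decode_step_def w by auto
  ultimately show ?case using step.hyps(1) decode_step_sound by blast
qed

text \<open>Indices of the two targets, bounded by \<open>index_exists\<close>, serve as the two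
  programs.\<close>

lemma decode_step_complete:
  "decode_step \<langle>i, \<langle>N (Suc i), b\<rangle>\<rangle> \<langle>Suc i, \<langle>N (Suc (Suc i)), b'\<rangle>\<rangle>
    \<langle>Suc (Suc i), \<langle>N (Suc (Suc (Suc i))), of_bool (x (Suc (Suc i)))\<rangle>\<rangle>"
proof -
  let ?j = "Suc (Suc i)" and ?g = "Suc (Suc i) mod 3"
  let ?n = "N (Suc ?j)" and ?\<beta> = "of_bool (x ?j) :: nat"
  have "\<exists>e<Suc (N (Suc i)). (\<forall>t<?n. ev c e t (yval ?j ?\<beta> t)) \<and> ev c e ?n (1 - yval ?j ?\<beta> ?n)"
  proof -
    obtain e where e: "e \<le> N (Suc i)" "\<And>t. ev c e t (of_bool (T ?j ?g (x ?j) t))"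
      using index_exists by blast
    have "ev c e t (yval ?j ?\<beta> t)" if "t < ?n" for t
      using e(2)[of t] y_eq_T[OF that] unfolding yval_of_bool by simp
    moreover have "1 - yval ?j ?\<beta> ?n = of_bool (T ?j ?g (x ?j) ?n)"
      using y_leaves[of ?j] unfolding yval_of_bool by auto
    ultimately show ?thesis using e by (metis less_Suc_eq_le)
  qed
  moreover have "\<exists>e<Suc (N (Suc i)). \<forall>t<Suc ?n. ev c e t (yval ?j (1 - ?\<beta>) t)"
  proof -
    obtain e where e: "e \<le> N (Suc i)" "\<And>t. ev c e t (of_bool (T ?j ?g (\<not> x ?j) t))"
      using index_exists by blast
    have "ev c e t (yval ?j (1 - ?\<beta>) t)" if "t < Suc ?n" for t
      using e(2)[of t] y_stays[of t ?j] that unfolding yval_of_bool by simp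
    then show ?thesis using e by (metis less_Suc_eq_le)
  qed
  moreover have "?\<beta> < 2" "N ?j < ?n" using N_less by (auto split: split_of_bool)
  ultimately show ?thesis unfolding decode_step_def by simp
qed

text \<open>Each step looks back two stages, so the first two triples have to be built into
  \<open>decode_base\<close>.\<close>

lemma decoded_complete: "decoded \<langle>j, \<langle>N (Suc j), of_bool (x j)\<rangle>\<rangle>"
proof (induction j rule: less_induct)
  case (less j)
  consider "j = 0" | "j = 1" | i where "j = Suc (Suc i)" by (metis One_nat_def not0_implies_Suc)
  then show ?case
  proof cases
    case 3
    then show ?thesis using ind_closure.step[OF decode_step_complete less[of i] less[of "Suc i"]] by simp
  qed (auto intro!: ind_closure.base simp: decode_base_def numeral_2_eq_2)
qed

text \<open>The correct triples are enumerable in \<open>d\<close>, and there is exactly one for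
  each stage. Projecting the position away leaves the graph of \<open>x\<close>.\<close>

theorem turing_le_decoded:
  assumes c: "turing_le c d" and y: "\<And>g \<beta>. g < 3 \<Longrightarrow> turing_le (y g \<beta>) d"
  shows "turing_le x d"
proof -
  have yg: "urec d (\<lambda>z. of_bool (y g \<beta> (f z)))" if "g < 3" "urec d f" for g \<beta> f
    using urec.comp[OF y[unfolded turing_le_iff_urec] that(2)] that(1) by blast
  \<comment> \<open>The six reals are given as computable from \<open>d\<close> one by one; a case
    distinction on pair and bit turns this into one procedure with the pair and bit as
    inputs.\<close>
  have yv: "urec d (\<lambda>z. yval (k z) (b z) (t z))" if kbt: "urec d k" "urec d b" "urec d t" for k b t
  proof -
    let ?R = "\<lambda>g z. k z mod 3 = g \<and> (b z = 1 \<and> y g True (t z) \<or> b z \<noteq> 1 \<and> y g False (t z))"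
    have "dec d (\<lambda>z. ?R 0 z \<or> ?R 1 z \<or> ?R 2 z)"
    proof -
      have "dec d (\<lambda>z. y g \<beta> (t z))" if "g < 3" for g \<beta>
        using yg[OF that kbt(3)] unfolding dec_def .
      then have "dec d (?R g)" if "g < 3" for g
        using that kbt by (intro dec_conj dec_disj dec_not dec_eq urec_mod urec_const) auto
      then show ?thesis by (intro dec_disj[where P = "?R _"]) auto
    qed
    moreover have "?R 0 z \<or> ?R 1 z \<or> ?R 2 z \<longleftrightarrow> y (k z mod 3) (b z = 1) (t z)" for z
    proof -
      have "k z mod 3 < 3" by simp
      then have "k z mod 3 = 0 \<or> k z mod 3 = 1 \<or> k z mod 3 = 2" by linarith
      then show ?thesis by (cases "b z = 1") auto
    qed
    ultimately show ?thesis unfolding dec_def yval_def by (simp only:)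
  qed
  have "re d decode_base" unfolding decode_base_def
    by (intro re_dec dec_disj dec_eq urec_intros)
  moreover have "re d (\<lambda>z. decode_step (p1 z) (p1 (p2 z)) (p2 (p2 z)))" unfolding decode_step_def
    by (intro re_conj re_bex re_ball re_ev[OF c[unfolded turing_le_iff_urec]]
        re_dec[OF dec_eq] re_dec[OF dec_less] yv urec_diff urec_intros)
  ultimately have decoded: "re d decoded" by (rule re_ind_closure)
  have "re d (\<lambda>z. \<exists>n. decoded \<langle>p1 z, \<langle>n, p2 z\<rangle>\<rangle>)"
    by (intro re_ex re_comp[OF decoded] urec_intros)
  moreover have "(\<exists>n. decoded \<langle>p1 z, \<langle>n, p2 z\<rangle>\<rangle>) \<longleftrightarrow> p2 z = of_bool (x (p1 z))" for z
  proof
    assume "\<exists>n. decoded \<langle>p1 z, \<langle>n, p2 z\<rangle>\<rangle>"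
    then obtain n where "decoded \<langle>p1 z, \<langle>n, p2 z\<rangle>\<rangle>" ..
    from decoded_sound[OF this] show "p2 z = of_bool (x (p1 z))" by auto
  next
    assume "p2 z = of_bool (x (p1 z))"
    then show "\<exists>n. decoded \<langle>p1 z, \<langle>n, p2 z\<rangle>\<rangle>" using decoded_complete[of "p1 z"] by auto
  qed
  ultimately have "dec d x" by (intro dec_of_re_graph) simp
  then show ?thesis unfolding turing_le_iff_urec dec_def .
qed

end

section \<open>Perfect sets and the partial order\<close>

lemma open_cylinder: "open {z :: nat \<Rightarrow> bool. \<forall>t<n. z t = b t}"
proof -
  have "open ((\<lambda>z :: nat \<Rightarrow> bool. z t) -` {b t})" for t
    by (rule open_vimage[OF open_discrete continuous_on_product_coordinates])
  then have "open (\<Inter>t\<in>{..<n}. (\<lambda>z :: nat \<Rightarrow> bool. z t) -` {b t})" by (intro open_INT) auto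
  moreover have "(\<Inter>t\<in>{..<n}. (\<lambda>z :: nat \<Rightarrow> bool. z t) -` {b t}) = {z. \<forall>t<n. z t = b t}" by auto
  ultimately show ?thesis by simp
qed

text \<open>The approximating points are eventually constant in every coordinate, and coordinatewise
  convergence is convergence in the product topology.\<close>

lemma closed_cylinder_limit:
  fixes A :: "(nat \<Rightarrow> bool) set"
  assumes "closed A" "\<And>n. \<exists>a\<in>A. \<forall>t<n. a t = y t"
  shows "y \<in> A"
proof -
  obtain a where a: "\<And>n. a n \<in> A" "\<And>n t. t < n \<Longrightarrow> a n t = y t" using assms(2) by metis
  have "((\<lambda>n. a n t) \<longlongrightarrow> y t) sequentially" for t
    by (rule tendsto_eventually, rule eventually_mono[OF eventually_gt_at_top[of t]]) (rule a(2))
  then have "limitin (product_topology (\<lambda>i. euclidean) UNIV) a y sequentially"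
    by (simp add: limitin_componentwise)
  then have "(a \<longlongrightarrow> y) sequentially" by (simp add: euclidean_product_topology)
  then show ?thesis using assms(1) a(1) by (auto intro: closed_sequentially)
qed

text \<open>\<open>B\<close> takes one point of \<open>A\<close> through each finite string that
  \<open>A\<close> meets. To leave \<open>b\<close> late, perfectness gives another point of
  \<open>A\<close> close to \<open>b\<close>, and a member of \<open>B\<close> copies it through its
  first difference from \<open>b\<close>.\<close>

lemma countable_dense_splitting:
  assumes "perfect_set A"
  obtains B where "B \<subseteq> A" "countable B" "B \<noteq> {}"
    "\<And>b N. b \<in> B \<Longrightarrow> \<exists>b'\<in>B. \<exists>n\<ge>N. (\<forall>t<n. b' t = b t) \<and> b' n \<noteq> b n"
proof -
  define pick where "pick l = (SOME a. a \<in> A \<and> map a [0..<length l] = l)" for l :: "bool list"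
  define B where "B = pick ` {l. \<exists>a\<in>A. map a [0..<length l] = l}"
  have pick: "pick l \<in> A \<and> map (pick l) [0..<length l] = l" if "a \<in> A" "map a [0..<length l] = l" for a l
    unfolding pick_def by (rule someI[of _ a]) (use that in simp)
  have dense: "\<exists>b\<in>B. \<forall>t<n. b t = a t" if "a \<in> A" for a n
  proof -
    let ?l = "map a [0..<n]"
    have "map a [0..<length ?l] = ?l" by simp
    from pick[OF that this] have "map (pick ?l) [0..<n] = ?l" by simp
    then have "\<forall>t<n. pick ?l t = a t" by simp
    moreover have "pick ?l \<in> B" unfolding B_def using that by (intro imageI) auto
    ultimately show ?thesis by blast
  qed
  have BA: "B \<subseteq> A" unfolding B_def using pick by blast
  have "countable B" unfolding B_def by simp
  moreover have "B \<noteq> {}" using dense assms unfolding perfect_set_def by blast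
  moreover have "\<exists>b'\<in>B. \<exists>n\<ge>N. (\<forall>t<n. b' t = b t) \<and> b' n \<noteq> b n" if "b \<in> B" for b N
  proof -
    have "b islimpt A" using that BA assms unfolding perfect_set_def by blast
    then obtain a where a: "a \<in> A" "a \<noteq> b" "\<forall>t<N. a t = b t"
      using islimptE[OF _ _ open_cylinder[of N b]] by blast
    define n where "n = (LEAST n. a n \<noteq> b n)"
    have n: "a n \<noteq> b n" unfolding n_def using a(2) LeastI_ex[of "\<lambda>n. a n \<noteq> b n"] by auto
    have less: "a t = b t" if "t < n" for t using not_less_Least that unfolding n_def by blast
    have "N \<le> n" using n a(3) not_le by blast
    moreover obtain b' where "b' \<in> B" "\<forall>t<Suc n. b' t = a t" using dense[OF a(1)] by blast
    ultimately show ?thesis using n less by (intro bexI[of _ b'] exI[of _ n]) auto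
  qed
  ultimately show thesis using that[OF BA] by blast
qed

text \<open>Dependent choice runs the construction with all targets in \<open>B\<close>, and
  closedness puts the limits into \<open>A\<close>. The limits are fixed before \<open>d\<close>, so
  they can be placed below a point of the order afterwards.\<close>

theorem perfect_set_coding:
  assumes A: "perfect_set A" and BA: "B \<subseteq> A" "B \<noteq> {}"
    and split: "\<And>b N. b \<in> B \<Longrightarrow> \<exists>b'\<in>B. \<exists>n\<ge>N. (\<forall>t<n. b' t = b t) \<and> b' n \<noteq> b n"
    and B: "\<And>b. b \<in> B \<Longrightarrow> turing_le b c"
  obtains y :: "nat \<Rightarrow> bool \<Rightarrow> nat \<Rightarrow> bool" where "\<And>g \<beta>. y g \<beta> \<in> A"
    "\<And>d. turing_le c d \<Longrightarrow> (\<And>g \<beta>. g < 3 \<Longrightarrow> turing_le (y g \<beta>) d) \<Longrightarrow> turing_le x d"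
proof -
  \<comment> \<open>Any state with its targets in \<open>B\<close> may start the construction; here
    all targets are the same point.\<close>
  obtain b0 where "b0 \<in> B" using BA by blast
  then have "\<exists>s :: (nat \<Rightarrow> bool \<Rightarrow> nat \<Rightarrow> bool) \<times> nat. \<forall>g \<beta>. fst s g \<beta> \<in> B"
    by (intro exI[of _ "(\<lambda>_ _. b0, 0 :: nat)"]) simp
  moreover have "\<exists>s'. (\<forall>g \<beta>. fst s' g \<beta> \<in> B) \<and> coding_step c x j s s'" if "\<forall>g \<beta>. fst s g \<beta> \<in> B" for s j
    using coding_step_exists[OF B split, of "fst s" x j "snd s"] that by fastforce
  ultimately obtain s where s: "\<And>j g \<beta>. fst (s j) g \<beta> \<in> B" "\<And>j. coding_step c x j (s j) (s (Suc j))"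
    using dependent_nat_choice[of "\<lambda>_ s. \<forall>g \<beta>. fst s g \<beta> \<in> B" "coding_step c x"] by metis
  interpret coding c x "\<lambda>j. fst (s j)" "\<lambda>j. snd (s j)"
    by unfold_locales (simp add: s(2))
  have "y g \<beta> \<in> A" for g \<beta>
  proof (rule closed_cylinder_limit)
    show "closed A" using A unfolding perfect_set_def by blast
    show "\<exists>a\<in>A. \<forall>t<n. a t = y g \<beta> t" for n
      using y_eq_T[of _ n g \<beta>] N_ge[of "Suc n"] s(1)[of n g \<beta>] BA(1)
      by (intro bexI[of _ "fst (s n) g \<beta>"]) auto
  qed
  then show thesis using that turing_le_decoded by blast
qed

section \<open>The order and its representation by reals\<close>

datatype elt = L1 "nat \<Rightarrow> bool" | L2 "nat \<Rightarrow> nat \<Rightarrow> bool" | L3 "nat \<Rightarrow> nat \<Rightarrow> bool" "nat \<Rightarrow> nat \<Rightarrow> bool"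

text \<open>Upper points are sequences and not their ranges: different sequences with the same range
  give incomparable points. So \<open>L2 S'\<close> fails to lie below \<open>L3 S F\<close> as soon
  as \<open>S'\<close> differs from \<open>S\<close>.\<close>

fun elt_le :: "elt \<Rightarrow> elt \<Rightarrow> bool" where
  "elt_le (L1 a) (L1 a') \<longleftrightarrow> a = a'"
| "elt_le (L1 a) (L2 S) \<longleftrightarrow> a \<in> range S"
| "elt_le (L1 a) (L3 S F) \<longleftrightarrow> a \<in> range S \<union> range F"
| "elt_le (L2 S) (L2 S') \<longleftrightarrow> S = S'"
| "elt_le (L2 S) (L3 S' F) \<longleftrightarrow> S = S'"
| "elt_le (L3 S F) (L3 S' F') \<longleftrightarrow> S = S' \<and> F = F'"
| "elt_le _ _ \<longleftrightarrow> False"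

fun level :: "elt \<Rightarrow> nat" where
  "level (L1 a) = 0"
| "level (L2 S) = 1"
| "level (L3 S F) = 2"

text \<open>The carrier of the order has to be a set of reals. Column 0 of the code marks the level
  by a single point, and columns 2 and 3 hold the data.\<close>

fun real_code :: "elt \<Rightarrow> nat \<Rightarrow> bool" where
  "real_code (L1 a) n = (p1 n = 0 \<and> p2 n = 0 \<or> p1 n = 2 \<and> a (p2 n))"
| "real_code (L2 S) n = (p1 n = 0 \<and> p2 n = 1 \<or> p1 n = 2 \<and> S (p1 (p2 n)) (p2 (p2 n)))"
| "real_code (L3 S F) n = (p1 n = 0 \<and> p2 n = 2 \<or> p1 n = 2 \<and> S (p1 (p2 n)) (p2 (p2 n))
     \<or> p1 n = 3 \<and> F (p1 (p2 n)) (p2 (p2 n)))"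

lemma inj_real_code: "inj real_code"
proof (rule injI)
  fix u v assume "real_code u = real_code v"
  then have *: "real_code u \<langle>i, k\<rangle> = real_code v \<langle>i, k\<rangle>" for i k by simp
  have "level u = level v"
    using *[of 0 0] *[of 0 1] *[of 0 2] by (cases u; cases v) simp_all
  then show "u = v"
    using *[of 2 "\<langle>_, _\<rangle>"] *[of 2] *[of 3 "\<langle>_, _\<rangle>"]
    by (cases u; cases v) (auto simp: fun_eq_iff)
qed

lemma elt_le_refl: "elt_le u u"
  by (cases u) auto

lemma elt_le_antisym: "elt_le u v \<Longrightarrow> elt_le v u \<Longrightarrow> u = v"
  by (cases u; cases v) auto

lemma elt_le_trans: "elt_le u v \<Longrightarrow> elt_le v w \<Longrightarrow> elt_le u w"
  by (cases u; cases v; cases w) auto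

text \<open>Consequently \<open>level\<close> is injective on chains, which bounds the height by the
  number of levels.\<close>

lemma elt_le_level: "elt_le u v \<Longrightarrow> level u = level v \<Longrightarrow> u = v"
  by (cases u; cases v) auto

lemma countable_elt_preds: "countable {u. elt_le u v \<and> u \<noteq> v}"
proof -
  have "countable {u. elt_le u v}"
  proof (cases v)
    case (L1 a)
    have "{u. elt_le u v} \<subseteq> {L1 a}" by (auto simp: L1 elim: elt_le.elims)
    then show ?thesis by (rule countable_subset) simp
  next
    case (L2 S)
    have "{u. elt_le u v} \<subseteq> insert (L2 S) (L1 ` range S)" by (auto simp: L2 elim: elt_le.elims)
    then show ?thesis by (rule countable_subset) simp
  next
    case (L3 S F)
    have "{u. elt_le u v} \<subseteq> insert (L3 S F) (insert (L2 S) (L1 ` (range S \<union> range F)))"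
      by (auto simp: L3 elim: elt_le.elims)
    then show ?thesis by (rule countable_subset) simp
  qed
  then show ?thesis by (rule countable_subset[rotated]) blast
qed

lemma elt_minimal_iff: "(\<forall>u. elt_le u v \<longrightarrow> u = v) \<longleftrightarrow> v \<in> range L1"
proof (cases v)
  case (L1 a)
  have "u = L1 a" if "elt_le u (L1 a)" for u using that by (cases u) auto
  then show ?thesis by (auto simp: L1)
next
  case (L2 S)
  have "elt_le (L1 (S 0)) v" "L1 (S 0) \<noteq> v" by (auto simp: L2)
  then show ?thesis using L2 by blast
next
  case (L3 S F)
  have "elt_le (L2 S) v" "L2 S \<noteq> v" by (auto simp: L3)
  then show ?thesis using L3 by blast
qed

theorem no_embedding:
  assumes emb: "\<And>u v. elt_le u v \<longleftrightarrow> turing_le (f u) (f v)"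
    and A: "perfect_set A" "\<And>a. a \<in> A \<Longrightarrow> \<exists>q. turing_equiv a (f (L1 q))"
  shows False
proof -
  obtain h where h: "\<And>a. a \<in> A \<Longrightarrow> turing_le a (f (L1 (h a)))"
    using A(2) unfolding turing_equiv_def by metis
  obtain B where B: "B \<subseteq> A" "countable B" "B \<noteq> {}"
    "\<And>b N. b \<in> B \<Longrightarrow> \<exists>b'\<in>B. \<exists>n\<ge>N. (\<forall>t<n. b' t = b t) \<and> b' n \<noteq> b n"
    using countable_dense_splitting[OF A(1)] by blast
  define S where "S n = h (from_nat_into B n)" for n
  \<comment> \<open>The image of \<open>L2 S'\<close> is the real that will be coded.\<close>
  obtain S' :: "nat \<Rightarrow> nat \<Rightarrow> bool" where S': "S' \<noteq> S"
    by (metis (full_types) fun_upd_same)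
  have below: "turing_le a (f v)" if "a \<in> A" "elt_le (L1 (h a)) v" for a v
    using turing_le_trans[OF h] emb that by blast
  have "turing_le b (f (L2 S))" if b: "b \<in> B" for b
  proof (rule below)
    show "b \<in> A" using b B(1) by blast
    obtain n where "from_nat_into B n = b" using from_nat_into_surj[OF B(2) b] by blast
    then show "elt_le (L1 (h b)) (L2 S)" unfolding S_def by auto
  qed
  then obtain y :: "nat \<Rightarrow> bool \<Rightarrow> nat \<Rightarrow> bool" where y: "\<And>g \<beta>. y g \<beta> \<in> A"
    "\<And>d. turing_le (f (L2 S)) d \<Longrightarrow> (\<And>g \<beta>. g < 3 \<Longrightarrow> turing_le (y g \<beta>) d) \<Longrightarrow> turing_le (f (L2 S')) d"
    using perfect_set_coding[OF A(1) B(1,3,4), of "f (L2 S)" "f (L2 S')"] by blast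
  \<comment> \<open>The quotient by 2 selects the pair and the parity selects the member.\<close>
  define F where "F n = h (y (n div 2) (odd n))" for n
  have "turing_le (y g \<beta>) (f (L3 S F))" for g \<beta>
  proof (rule below[OF y(1)])
    have "h (y g \<beta>) = F (2 * g + of_bool \<beta>)" unfolding F_def by (cases \<beta>) auto
    then show "elt_le (L1 (h (y g \<beta>))) (L3 S F)" by auto
  qed
  moreover have "turing_le (f (L2 S)) (f (L3 S F))" using emb[of "L2 S" "L3 S F"] by simp
  ultimately have "turing_le (f (L2 S')) (f (L3 S F))" by (intro y(2))
  then show False using emb[of "L2 S'" "L3 S F"] S' by simp
qed

theorem theorem1p2:
  shows "\<exists>(P :: (nat \<Rightarrow> bool) set) (le :: (nat \<Rightarrow> bool) \<Rightarrow> (nat \<Rightarrow> bool) \<Rightarrow> bool).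
    partial_order_on_set P le \<and>
    locally_countable P le \<and>
    P \<approx> (UNIV :: (nat \<Rightarrow> bool) set) \<and>
    has_height P le 3 \<and>
    first_level P le \<approx> (UNIV :: (nat \<Rightarrow> bool) set) \<and>
    (\<forall>f :: (nat \<Rightarrow> bool) \<Rightarrow> (nat \<Rightarrow> bool).
       (\<exists>A. perfect_set A \<and> (\<forall>a\<in>A. \<exists>p\<in>first_level P le. turing_equiv a (f p)))
       \<longrightarrow> \<not> turing_embedding P le f)"
proof -
  define P where "P = range real_code"
  define le where "le u v = elt_le (inv real_code u) (inv real_code v)" for u v
  note inj = inj_real_code
  have le: "le (real_code u) (real_code v) \<longleftrightarrow> elt_le u v" for u v
    unfolding le_def by (simp add: inv_f_f[OF inj])
  have eq: "real_code u = real_code v \<longleftrightarrow> u = v" for u v using inj by (simp add: inj_eq)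
  have "partial_order_on_set P le"
    unfolding partial_order_on_set_def P_def
    by (auto simp: le elt_le_refl eq dest: elt_le_antisym intro: elt_le_trans)
  moreover have preds: "strict_preds P le (real_code v) = real_code ` {u. elt_le u v \<and> u \<noteq> v}" for v
    unfolding strict_preds_def P_def by (auto simp: le eq)
  then have "locally_countable P le"
    unfolding locally_countable_def P_def using countable_elt_preds by auto
  moreover have first: "first_level P le = real_code ` range L1"
  proof -
    have "first_level P le = {z \<in> range real_code. strict_preds P le z = {}}"
      unfolding first_level_def P_def ..
    also have "\<dots> = real_code ` {v. \<forall>u. elt_le u v \<longrightarrow> u = v}" by (auto simp: preds)
    finally show ?thesis unfolding elt_minimal_iff by simp
  qed
  have "inj (\<lambda>a. real_code (L1 a))" using inj by (auto simp: inj_def)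
  then have L1: "real_code ` range L1 \<approx> (UNIV :: (nat \<Rightarrow> bool) set)"
    using inj_on_image_eqpoll_self by (fastforce simp: image_image)
  then have "first_level P le \<approx> (UNIV :: (nat \<Rightarrow> bool) set)" using first by simp
  moreover have "P \<approx> (UNIV :: (nat \<Rightarrow> bool) set)"
  proof (rule lepoll_antisym)
    show "P \<lesssim> (UNIV :: (nat \<Rightarrow> bool) set)" by (simp add: subset_imp_lepoll)
    \<comment> \<open>The first level alone already gives the lower bound.\<close>
    have "(UNIV :: (nat \<Rightarrow> bool) set) \<lesssim> real_code ` range L1" using L1 by (simp add: eqpoll_imp_lepoll eqpoll_sym)
    then show "(UNIV :: (nat \<Rightarrow> bool) set) \<lesssim> P"
      unfolding P_def by (rule lepoll_trans) (auto intro: subset_imp_lepoll)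
  qed
  moreover have "has_height P le 3"
    unfolding has_height_def
  proof (intro conjI allI impI)
    \<comment> \<open>A chain through all three levels, built from the constant sequence of the zero
      real.\<close>
    let ?a = "\<lambda>_. False" let ?S = "\<lambda>_. ?a"
    let ?C = "{L1 ?a, L2 ?S, L3 ?S ?S}"
    have "is_chain P le (real_code ` ?C)" unfolding is_chain_def P_def by (auto simp: le)
    moreover have "card (real_code ` ?C) = 3"
      by (subst card_image[OF inj_on_subset[OF inj]]) simp_all
    ultimately show "\<exists>C. is_chain P le C \<and> finite C \<and> card C = 3" by (metis finite.intros finite_imageI)
  next
    fix C assume C: "is_chain P le C"
    let ?l = "\<lambda>u. level (inv real_code u)"
    have "inj_on ?l C"
    proof (rule inj_onI)
      fix u v assume uv: "u \<in> C" "v \<in> C" "?l u = ?l v"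
      then obtain u' v' where *: "u = real_code u'" "v = real_code v'"
        using C unfolding is_chain_def P_def by blast
      then have "elt_le u' v' \<or> elt_le v' u'" using C uv le unfolding is_chain_def by blast
      moreover have "level u' = level v'" using uv(3) * by (simp add: inv_f_f[OF inj])
      ultimately show "u = v" using elt_le_level * by metis
    qed
    moreover have "?l ` C \<subseteq> {..<3}"
    proof
      fix i assume "i \<in> ?l ` C"
      then obtain u where "i = ?l u" by blast
      then show "i \<in> {..<3}" by (cases "inv real_code u") auto
    qed
    ultimately show "finite C" "card C \<le> 3"
      using inj_on_finite[of ?l C "{..<3}"] card_inj_on_le[of ?l C "{..<3}"] by auto
  qed
  moreover have "\<not> turing_embedding P le f"
    if "perfect_set A" "\<forall>a\<in>A. \<exists>p\<in>first_level P le. turing_equiv a (f p)" for f A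
  proof
    assume emb: "turing_embedding P le f"
    show False
    proof (rule no_embedding[of "\<lambda>u. f (real_code u)" A])
      show "elt_le u v \<longleftrightarrow> turing_le (f (real_code u)) (f (real_code v))" for u v
        using emb le unfolding turing_embedding_def P_def by blast
      show "perfect_set A" by fact
      show "\<exists>q. turing_equiv a (f (real_code (L1 q)))" if "a \<in> A" for a
        using \<open>\<forall>a\<in>A. _\<close> that unfolding first by blast
    qed
  qed
  ultimately show ?thesis by blast
qed

end
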